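(* For any monoid $M$, the clone $\mathsf{Pill}_{1,1}(M)=\mathbf{P}(M)/_\equiv$ admits the presentation $(\mathcal{G}_M,\mathcal{R}'_M)$, where $\mathcal{R}'_M$ is the equivalence relation on $\mathbf{T}(\mathcal{G}_M)$ generated by $\mathcal{R}_M$ together with the equations $\mathrm{rc}_M(1^{\alpha_1}1^{\alpha_2}2^e3^e1^{\alpha_3})\sim\mathrm{rc}_M(1^{\alpha_1}2^e1^{\alpha_2}3^e1^{\alpha_3})\sim\mathrm{rc}_M(1^{\alpha_1}2^e3^e1^{\alpha_2}1^{\alpha_3})$ (in arity $3$) and $\mathrm{rc}_M(1^{\alpha_1}2^e3^{\beta_1}1^{\alpha_2}4^e3^{\beta_2})\sim\mathrm{rc}_M(1^{\alpha_1}2^e1^{\alpha_2}3^{\beta_1}4^e3^{\beta_2})$ (in arity $4$), for all $\alpha_1,\alpha_2,\alpha_3,\beta_1,\beta_2\in M$, where $e$ is the unit of $M$.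
   Context: Clones: a clone $C$ is a graded set with superposition maps $C(n)\times C(m)^n\to C(m)$, $x[y_1,\dots,y_n]$, and projections $\mathbf{1}_{i,n}$ satisfying $\mathbf{1}_{i,n}[y_1,\dots,y_n]=y_i$, $x[\mathbf{1}_{1,n},\dots,\mathbf{1}_{n,n}]=x$ and $x[y_1,\dots,y_n][z_1,\dots,z_m]=x[y_1[z_1,\dots,z_m],\dots,y_n[z_1,\dots,z_m]]$; clone congruences are arity-preserving equivalence relations compatible with superposition. Let $(M,\cdot,e)$ be a monoid. $M$-pigmented letters are pairs $i^\alpha$ ($i\ge1$, $\alpha\in M$); $\mathbf{P}(M)(n)$ is the set of words of such letters with values in $[n]$. With $\alpha\odot i_1^{\alpha_1}\cdots i_\ell^{\alpha_\ell}:=i_1^{\alpha\alpha_1}\cdots i_\ell^{\alpha\alpha_\ell}$, $\mathbf{P}(M)$ is the clone with $i_1^{\alpha_1}\cdots i_\ell^{\alpha_\ell}[\mathfrak{p}_1,\dots,\mathfrak{p}_n]:=(\alpha_1\odot\mathfrak{p}_{i_1})\cdots(\alpha_\ell\odot\mathfrak{p}_{i_\ell})$ and projections $i^e$. A position $j$ of a word is a left (resp. right) $1$-witness if no earlier (resp. later) letter has the same value; $\mathrm{first}_1(\mathfrak{p})$ (resp. $\mathrm{first}_1^R(\mathfrak{p})$) is the subword of letters at left (resp. right) $1$-witness positions. $\equiv$: $\mathfrak{p}\equiv\mathfrak{p}'$ iff same arity, same multiset of pigmented letters, $\mathrm{first}_1(\mathfrak{p})=\mathrm{first}_1(\mathfrak{p}')$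 and $\mathrm{first}_1^R(\mathfrak{p})=\mathrm{first}_1^R(\mathfrak{p}')$; it is a clone congruence and $\mathsf{Pill}_{1,1}(M):=\mathbf{P}(M)/_\equiv$. Terms: $\mathbf{T}(\mathcal{G})(n)$ is the set of $\mathcal{G}$-terms with variables among $x_1,\dots,x_n$ (free clone: superposition = substitution, projections $x_i$). For $(\mathcal{G},\mathcal{R})$, $\equiv_{\mathcal{R}}$ is the smallest clone congruence containing $\mathcal{R}$; $(\mathcal{G},\mathcal{R})$ is a presentation of $C$ if $C\cong\mathbf{T}(\mathcal{G})/_{\equiv_{\mathcal{R}}}$. $\mathcal{G}_M(0)=\{\mathsf{u}\}$, $\mathcal{G}_M(1)=\{\mathsf{p}_\alpha:\alpha\in M\}$, $\mathcal{G}_M(2)=\{\star\}$; $\mathcal{R}_M$ is generated by $\star[\star[x_1,x_2],x_3]\sim\star[x_1,\star[x_2,x_3]]$, $\star[\mathsf{u},x_1]\sim x_1\sim\star[x_1,\mathsf{u}]$, $\mathsf{p}_\alpha[\star[x_1,x_2]]\sim\star[\mathsf{p}_\alpha[x_1],\mathsf{p}_\alpha[x_2]]$, $\mathsf{p}_\alpha[\mathsf{u}]\sim\mathsf{u}$, $\mathsf{p}_{\alpha_1}[\mathsf{p}_{\alpha_2}[x_1]]\sim\mathsf{p}_{\alpha_1\alpha_2}[x_1]$, $\mathsf{p}_e[x_1]\sim x_1$. Right comb map: $\mathrm{rc}_M(\epsilon)=\mathsf{u}$, $\mathrm{rc}_M(i^\alpha\mathfrak{p}')=\star[\mathsf{p}_\alpha[x_i],\mathrm{rc}_M(\mathfrak{p}')]$.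 *)

theory Defs
  imports "HOL-Algebra.Group" "HOL-Library.Multiset"
begin

section \<open>Clones\<close>

text \<open>
  A graded set is a family of sets indexed by the arity; the same HOL value may occur in several
  arities.  In \<open>superpos C n m x ys\<close>, the list \<open>ys\<close> has length \<open>n\<close> and its members have
  arity \<open>m\<close>.  The target arity \<open>m\<close> has to be an explicit argument because it
  cannot be read off \<open>ys\<close> when \<open>n = 0\<close>.  Projections \<open>projection C i n\<close> are indexed
  from \<open>1\<close>, lists from \<open>0\<close>.
\<close>

record 'a clone =
  elems :: "nat \<Rightarrow> 'a set"
  superpos :: "nat \<Rightarrow> nat \<Rightarrow> 'a \<Rightarrow> 'a list \<Rightarrow> 'a"
  projection :: "nat \<Rightarrow> nat \<Rightarrow> 'a"

definition tuples :: "'a clone \<Rightarrow> nat \<Rightarrow> nat \<Rightarrow> 'a list set" where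
  "tuples C n m = {ys. length ys = n \<and> set ys \<subseteq> elems C m}"

locale clone =
  fixes C :: "'a clone"
  assumes superpos_closed:
      "\<lbrakk>x \<in> elems C n; ys \<in> tuples C n m\<rbrakk> \<Longrightarrow> superpos C n m x ys \<in> elems C m"
    and projection_closed:
      "\<lbrakk>1 \<le> i; i \<le> n\<rbrakk> \<Longrightarrow> projection C i n \<in> elems C n"
    and projection_superpos:
      "\<lbrakk>1 \<le> i; i \<le> n; ys \<in> tuples C n m\<rbrakk>
        \<Longrightarrow> superpos C n m (projection C i n) ys = ys ! (i - 1)"
    and superpos_projections:
      "x \<in> elems C n \<Longrightarrow> superpos C n n x (map (\<lambda>i. projection C i n) [1..<Suc n]) = x"
    and superpos_assoc:
      "\<lbrakk>x \<in> elems C n; ys \<in> tuples C n m; zs \<in> tuples C m k\<rbrakk>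
        \<Longrightarrow> superpos C m k (superpos C n m x ys) zs =
            superpos C n k x (map (\<lambda>y. superpos C m k y zs) ys)"

definition clone_congruence :: "'a clone \<Rightarrow> (nat \<Rightarrow> ('a \<times> 'a) set) \<Rightarrow> bool" where
  "clone_congruence C R \<longleftrightarrow>
    (\<forall>n. equiv (elems C n) (R n)) \<and>
    (\<forall>n m x x' ys ys'.
      (x, x') \<in> R n \<longrightarrow> length ys = n \<longrightarrow> list_all2 (\<lambda>y y'. (y, y') \<in> R m) ys ys' \<longrightarrow>
      (superpos C n m x ys, superpos C n m x' ys') \<in> R m)"

text \<open>
  The union over all representatives collapses to a single class when \<open>R\<close> is a
  congruence.
\<close>

definition quotient_clone :: "'a clone \<Rightarrow> (nat \<Rightarrow> ('a \<times> 'a) set) \<Rightarrow> 'a set clone" where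
  "quotient_clone C R =
    \<lparr>elems = (\<lambda>n. elems C n // R n),
     superpos = (\<lambda>n m X Ys. \<Union>x\<in>X. \<Union>ys\<in>listset Ys. R m `` {superpos C n m x ys}),
     projection = (\<lambda>i n. R n `` {projection C i n})\<rparr>"

definition clone_iso :: "'a clone \<Rightarrow> 'b clone \<Rightarrow> (nat \<Rightarrow> 'a \<Rightarrow> 'b) \<Rightarrow> bool" where
  "clone_iso C D \<phi> \<longleftrightarrow>
    (\<forall>n. bij_betw (\<phi> n) (elems C n) (elems D n)) \<and>
    (\<forall>i n. 1 \<le> i \<longrightarrow> i \<le> n \<longrightarrow> \<phi> n (projection C i n) = projection D i n) \<and>
    (\<forall>n m. \<forall>x\<in>elems C n. \<forall>ys\<in>tuples C n m.
      \<phi> m (superpos C n m x ys) = superpos D n m (\<phi> n x) (map (\<phi> m) ys))"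

definition clone_isomorphic :: "'a clone \<Rightarrow> 'b clone \<Rightarrow> bool" where
  "clone_isomorphic C D \<longleftrightarrow> (\<exists>\<phi>. clone_iso C D \<phi>)"


section \<open>Terms and presentations\<close>

text \<open>
  Variables are indexed from \<open>1\<close>.  The arity of an occurrence of a symbol is the number of its
  arguments.
\<close>

datatype 'g tm = Var nat | App 'g "'g tm list"

inductive_set terms :: "(nat \<Rightarrow> 'g set) \<Rightarrow> nat \<Rightarrow> 'g tm set"
  for G :: "nat \<Rightarrow> 'g set" and n :: nat where
  Var: "\<lbrakk>1 \<le> i; i \<le> n\<rbrakk> \<Longrightarrow> Var i \<in> terms G n"
| App: "\<lbrakk>g \<in> G (length ts); \<forall>t\<in>set ts. t \<in> terms G n\<rbrakk> \<Longrightarrow> App g ts \<in> terms G n"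

fun tm_subst :: "'g tm list \<Rightarrow> 'g tm \<Rightarrow> 'g tm" where
  "tm_subst ts (Var i) = ts ! (i - 1)"
| "tm_subst ts (App g us) = App g (map (tm_subst ts) us)"

definition term_clone :: "(nat \<Rightarrow> 'g set) \<Rightarrow> 'g tm clone" where
  "term_clone G =
    \<lparr>elems = terms G, superpos = (\<lambda>n m t ts. tm_subst ts t), projection = (\<lambda>i n. Var i)\<rparr>"

definition generated_equiv ::
    "(nat \<Rightarrow> 'a set) \<Rightarrow> (nat \<Rightarrow> ('a \<times> 'a) set) \<Rightarrow> nat \<Rightarrow> ('a \<times> 'a) set" where
  "generated_equiv A R n = \<Inter>{E. equiv (A n) E \<and> R n \<subseteq> E}"

definition generated_congruence ::
    "'a clone \<Rightarrow> (nat \<Rightarrow> ('a \<times> 'a) set) \<Rightarrow> nat \<Rightarrow> ('a \<times> 'a) set" where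
  "generated_congruence C R n = \<Inter>{S n | S. clone_congruence C S \<and> (\<forall>k. R k \<subseteq> S k)}"

definition presentation_of ::
    "(nat \<Rightarrow> 'g set) \<Rightarrow> (nat \<Rightarrow> ('g tm \<times> 'g tm) set) \<Rightarrow> 'a clone \<Rightarrow> bool" where
  "presentation_of G R C \<longleftrightarrow>
    clone C \<and> (\<forall>n. equiv (terms G n) (R n)) \<and>
    clone_isomorphic C
      (quotient_clone (term_clone G) (generated_congruence (term_clone G) R))"


section \<open>Pigmented words\<close>

type_synonym 'm pword = "(nat \<times> 'm) list"

definition pwords :: "('m, 'b) monoid_scheme \<Rightarrow> nat \<Rightarrow> 'm pword set" where
  "pwords M n = lists ({1..n} \<times> carrier M)"

definition pigment_act :: "('m, 'b) monoid_scheme \<Rightarrow> 'm \<Rightarrow> 'm pword \<Rightarrow> 'm pword" where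
  "pigment_act M \<alpha> p = map (\<lambda>(i, \<beta>). (i, \<alpha> \<otimes>\<^bsub>M\<^esub> \<beta>)) p"

definition pword_clone :: "('m, 'b) monoid_scheme \<Rightarrow> 'm pword clone" where
  "pword_clone M =
    \<lparr>elems = pwords M,
     superpos = (\<lambda>n m p qs. concat (map (\<lambda>(i, \<alpha>). pigment_act M \<alpha> (qs ! (i - 1))) p)),
     projection = (\<lambda>i n. [(i, \<one>\<^bsub>M\<^esub>)])\<rparr>"

definition left_witness :: "'m pword \<Rightarrow> nat \<Rightarrow> bool" where
  "left_witness p j \<longleftrightarrow> j < length p \<and> (\<forall>j'<j. fst (p ! j') \<noteq> fst (p ! j))"

definition right_witness :: "'m pword \<Rightarrow> nat \<Rightarrow> bool" where
  "right_witness p j \<longleftrightarrow>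
    j < length p \<and> (\<forall>j'. j < j' \<and> j' < length p \<longrightarrow> fst (p ! j') \<noteq> fst (p ! j))"

definition first1 :: "'m pword \<Rightarrow> 'm pword" where
  "first1 p = nths p {j. left_witness p j}"

definition first1R :: "'m pword \<Rightarrow> 'm pword" where
  "first1R p = nths p {j. right_witness p j}"

definition pill_rel :: "('m, 'b) monoid_scheme \<Rightarrow> nat \<Rightarrow> ('m pword \<times> 'm pword) set" where
  "pill_rel M n =
    {(p, p'). p \<in> pwords M n \<and> p' \<in> pwords M n \<and>
      mset p = mset p' \<and> first1 p = first1 p' \<and> first1R p = first1R p'}"

definition Pill11 :: "('m, 'b) monoid_scheme \<Rightarrow> 'm pword set clone" where
  "Pill11 M = quotient_clone (pword_clone M) (pill_rel M)"


section \<open>The generators and relations\<close>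

datatype 'm sym = SymU | SymP 'm | SymStar

definition sig :: "('m, 'b) monoid_scheme \<Rightarrow> nat \<Rightarrow> 'm sym set" where
  "sig M n =
    (if n = 0 then {SymU} else if n = 1 then SymP ` carrier M else if n = 2 then {SymStar} else {})"

abbreviation unit_tm :: "'m sym tm" where
  "unit_tm \<equiv> App SymU []"

abbreviation pig_tm :: "'m \<Rightarrow> 'm sym tm \<Rightarrow> 'm sym tm" where
  "pig_tm \<alpha> t \<equiv> App (SymP \<alpha>) [t]"

abbreviation star_tm :: "'m sym tm \<Rightarrow> 'm sym tm \<Rightarrow> 'm sym tm" where
  "star_tm s t \<equiv> App SymStar [s, t]"

inductive_set base_eqs :: "('m, 'b) monoid_scheme \<Rightarrow> (nat \<times> 'm sym tm \<times> 'm sym tm) set"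
  for M :: "('m, 'b) monoid_scheme" where
  star_assoc:
    "(3, star_tm (star_tm (Var 1) (Var 2)) (Var 3),
         star_tm (Var 1) (star_tm (Var 2) (Var 3))) \<in> base_eqs M"
| star_unit_left: "(1, star_tm unit_tm (Var 1), Var 1) \<in> base_eqs M"
| star_unit_right: "(1, Var 1, star_tm (Var 1) unit_tm) \<in> base_eqs M"
| pig_star:
    "\<alpha> \<in> carrier M \<Longrightarrow>
      (2, pig_tm \<alpha> (star_tm (Var 1) (Var 2)),
          star_tm (pig_tm \<alpha> (Var 1)) (pig_tm \<alpha> (Var 2))) \<in> base_eqs M"
| pig_unit: "\<alpha> \<in> carrier M \<Longrightarrow> (0, pig_tm \<alpha> unit_tm, unit_tm) \<in> base_eqs M"
| pig_pig:
    "\<lbrakk>\<alpha>1 \<in> carrier M; \<alpha>2 \<in> carrier M\<rbrakk> \<Longrightarrow>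
      (1, pig_tm \<alpha>1 (pig_tm \<alpha>2 (Var 1)), pig_tm (\<alpha>1 \<otimes>\<^bsub>M\<^esub> \<alpha>2) (Var 1)) \<in> base_eqs M"
| pig_one: "(1, pig_tm \<one>\<^bsub>M\<^esub> (Var 1), Var 1) \<in> base_eqs M"

definition base_rel :: "('m, 'b) monoid_scheme \<Rightarrow> nat \<Rightarrow> ('m sym tm \<times> 'm sym tm) set" where
  "base_rel M = generated_equiv (terms (sig M)) (\<lambda>n. {(s, t). (n, s, t) \<in> base_eqs M})"

fun rc :: "'m pword \<Rightarrow> 'm sym tm" where
  "rc [] = unit_tm"
| "rc ((i, \<alpha>) # p) = star_tm (pig_tm \<alpha> (Var i)) (rc p)"

inductive_set pill_eqs :: "('m, 'b) monoid_scheme \<Rightarrow> (nat \<times> 'm sym tm \<times> 'm sym tm) set"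
  for M :: "('m, 'b) monoid_scheme" where
  middle1:
    "\<lbrakk>\<alpha>1 \<in> carrier M; \<alpha>2 \<in> carrier M; \<alpha>3 \<in> carrier M\<rbrakk> \<Longrightarrow>
      (3, rc [(1, \<alpha>1), (1, \<alpha>2), (2, \<one>\<^bsub>M\<^esub>), (3, \<one>\<^bsub>M\<^esub>), (1, \<alpha>3)],
          rc [(1, \<alpha>1), (2, \<one>\<^bsub>M\<^esub>), (1, \<alpha>2), (3, \<one>\<^bsub>M\<^esub>), (1, \<alpha>3)]) \<in> pill_eqs M"
| middle2:
    "\<lbrakk>\<alpha>1 \<in> carrier M; \<alpha>2 \<in> carrier M; \<alpha>3 \<in> carrier M\<rbrakk> \<Longrightarrow>
      (3, rc [(1, \<alpha>1), (2, \<one>\<^bsub>M\<^esub>), (1, \<alpha>2), (3, \<one>\<^bsub>M\<^esub>), (1, \<alpha>3)],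
          rc [(1, \<alpha>1), (2, \<one>\<^bsub>M\<^esub>), (3, \<one>\<^bsub>M\<^esub>), (1, \<alpha>2), (1, \<alpha>3)]) \<in> pill_eqs M"
| exchange:
    "\<lbrakk>\<alpha>1 \<in> carrier M; \<alpha>2 \<in> carrier M; \<beta>1 \<in> carrier M; \<beta>2 \<in> carrier M\<rbrakk> \<Longrightarrow>
      (4, rc [(1, \<alpha>1), (2, \<one>\<^bsub>M\<^esub>), (3, \<beta>1), (1, \<alpha>2), (4, \<one>\<^bsub>M\<^esub>), (3, \<beta>2)],
          rc [(1, \<alpha>1), (2, \<one>\<^bsub>M\<^esub>), (1, \<alpha>2), (3, \<beta>1), (4, \<one>\<^bsub>M\<^esub>), (3, \<beta>2)]) \<in> pill_eqs M"

definition pill_pres_rel ::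
    "('m, 'b) monoid_scheme \<Rightarrow> nat \<Rightarrow> ('m sym tm \<times> 'm sym tm) set" where
  "pill_pres_rel M =
    generated_equiv (terms (sig M)) (\<lambda>n. base_rel M n \<union> {(s, t). (n, s, t) \<in> pill_eqs M})"

end

theory Submission
  imports Defs
begin

text \<open>
  Evaluating terms as pigmented words is a surjective clone homomorphism, and modulo the base
  equations every term equals the right comb of its value. It remains to see that two words with
  the same letters and the same left and right witnesses are connected by instances of the
  additional equations. The key observation is that these equations allow adjacent letters
  \<open>z y\<close> to be exchanged as soon as they are not both left witnesses and not both right
  witnesses: if one of them is neither, it moves freely between the first and the last occurrence
  of its value, and otherwise one is not a left and the other not a right witness, which is the
  arity 4 equation.
\<close>

section \<open>Witness subwords\<close>

text \<open>The exchange criterion is used in this form: one of the two values occurs before the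
  pair and one of them occurs after it. For distinct values this is the witness condition. For equal
  values it asks for an occurrence on each side, because exchanging two letters with the same value
  and different pigments alters a witness word as soon as the pair contains the first or the last
  occurrence of that value.

  Working from left to right treats the two witness words differently. A common prefix can be
  cancelled from \<open>first1R\<close> when the rests have the same values, but not from
  \<open>first1\<close>, since the prefix decides which later letters are left witnesses. The prefix
  therefore stays a parameter of the main induction.

  The generated congruence is never described by derivations. It is an intersection, so completeness
  is shown inside an arbitrary congruence containing the equations, and soundness amounts to
  exhibiting one such congruence: the pullback of \<open>pill_rel\<close> along evaluation.\<close>

abbreviation vals :: "'m pword \<Rightarrow> nat set" where
  "vals p \<equiv> fst ` set p"

lemma vals_conv_nth: "v \<in> vals p \<longleftrightarrow> (\<exists>j<length p. fst (p ! j) = v)"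
  by (metis image_iff in_set_conv_nth)

lemma first1R_Nil [simp]: "first1R [] = []"
  by (simp add: first1R_def)

text \<open>A letter added in front has no influence on the right witnesses behind it, so
  \<open>first1R\<close> recurses at the front, while \<open>first1\<close> recurses at the end in
  \<open>first1_snoc\<close>. The two rules replace positions by inductions.\<close>

lemma first1R_Cons [simp]:
  "first1R (x # p) = (if fst x \<in> vals p then first1R p else x # first1R p)"
proof -
  have "(\<forall>j'. 0 < j' \<and> j' < Suc (length p) \<longrightarrow> Q ((x # p) ! j')) \<longleftrightarrow>
      (\<forall>j<length p. Q (p ! j))" for Q :: "nat \<times> 'a \<Rightarrow> bool"
    by (metis Suc_less_eq gr0_conv_Suc nth_Cons_Suc zero_less_Suc)
  from this[of "\<lambda>y. fst y \<noteq> fst x"] have "right_witness (x # p) 0 \<longleftrightarrow> fst x \<notin> vals p"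
    by (simp add: right_witness_def vals_conv_nth)
  moreover have "right_witness (x # p) (Suc j) \<longleftrightarrow> right_witness p j" for j
  proof -
    have "(\<forall>k. Suc j < k \<and> k < Suc (length p) \<longrightarrow> Q k) \<longleftrightarrow>
        (\<forall>k. j < k \<and> k < length p \<longrightarrow> Q (Suc k))" for Q
      by (auto simp: Suc_less_eq2)
    then show ?thesis by (simp add: right_witness_def)
  qed
  ultimately show ?thesis
    by (simp add: first1R_def nths_Cons)
qed

lemma first1_Nil [simp]: "first1 [] = []"
  by (simp add: first1_def)

lemma first1_snoc:
  "first1 (p @ [x]) = first1 p @ (if fst x \<in> vals p then [] else [x])"
proof -
  have "left_witness (p @ [x]) (length p) \<longleftrightarrow> fst x \<notin> vals p"
    by (simp add: left_witness_def vals_conv_nth nth_append)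
  \<comment> \<open>\<open>nths\<close> only consults positions below \<open>length p\<close>, and
    their earlier letters are not affected by the appended one.\<close>
  moreover have "nths p {j. left_witness (p @ [x]) j} = nths p {j. left_witness p j}"
  proof -
    have "left_witness (p @ [x]) j \<longleftrightarrow> left_witness p j" if "j < length p" for j
      using that by (simp add: left_witness_def nth_append)
    then show ?thesis
      unfolding nths_def
      by (intro arg_cong[where f = "map fst"] filter_cong) (auto dest: set_zip_rightD)
  qed
  ultimately show ?thesis
    by (simp add: first1_def nths_append nths_singleton)
qed

lemma vals_first1 [simp]: "vals (first1 p) = vals p"
  by (induction p rule: rev_induct) (auto simp: first1_snoc)

lemma set_first1_subset: "set (first1 p) \<subseteq> set p"
  by (simp add: first1_def set_nths_subset)

lemma set_first1R_subset: "set (first1R p) \<subseteq> set p"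
  by (simp add: first1R_def set_nths_subset)

lemma first1_append:
  "first1 (p @ q) = first1 p @ filter (\<lambda>x. fst x \<notin> vals p) (first1 q)"
proof (induction q rule: rev_induct)
  case (snoc x q)
  then show ?case
    using first1_snoc[of "p @ q" x] by (simp add: first1_snoc image_Un)
qed simp

lemma first1R_append:
  "first1R (p @ q) = filter (\<lambda>x. fst x \<notin> vals q) (first1R p) @ first1R q"
  by (induction p) auto

lemma first1_Cons [simp]: "first1 (x # p) = x # filter (\<lambda>y. fst y \<noteq> fst x) (first1 p)"
  using first1_append[of "[x]" p] first1_snoc[of "[]" x] by simp

text \<open>Reversal exchanges the two kinds of witnesses; \<open>filter_vals_empty_first1R\<close>
  and \<open>first1R_psup_cong\<close> are obtained from their left counterparts in this
  way.\<close>

lemma first1R_conv_rev: "first1R p = rev (first1 (rev p))"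
  by (induction p) (auto simp: first1_snoc)

section \<open>Compatibility of the relation with superposition\<close>

text \<open>The substituted words form a function instead of a list, which keeps the shift
  \<open>i - 1\<close> and the arities out of the inductions; \<open>superpos_pword_clone\<close>
  makes the link.\<close>

definition psup :: "('m, 'b) monoid_scheme \<Rightarrow> 'm pword \<Rightarrow> (nat \<Rightarrow> 'm pword) \<Rightarrow> 'm pword" where
  "psup M p f = concat (map (\<lambda>(i, \<alpha>). pigment_act M \<alpha> (f i)) p)"

lemma psup_simps [simp]:
  "psup M [] f = []"
  "psup M ((i, \<alpha>) # p) f = pigment_act M \<alpha> (f i) @ psup M p f"
  "psup M (p @ q) f = psup M p f @ psup M q f"
  by (simp_all add: psup_def)

lemma pigment_act_simps [simp]:
  "pigment_act M \<alpha> [] = []"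
  "pigment_act M \<alpha> ((i, \<beta>) # p) = (i, \<alpha> \<otimes>\<^bsub>M\<^esub> \<beta>) # pigment_act M \<alpha> p"
  "pigment_act M \<alpha> (p @ q) = pigment_act M \<alpha> p @ pigment_act M \<alpha> q"
  by (simp_all add: pigment_act_def)

lemma vals_pigment_act [simp]: "vals (pigment_act M \<alpha> p) = vals p"
  by (simp add: pigment_act_def image_image case_prod_unfold)

lemma rev_pigment_act: "rev (pigment_act M \<alpha> p) = pigment_act M \<alpha> (rev p)"
  by (simp add: pigment_act_def rev_map)

lemma rev_psup: "rev (psup M p f) = psup M (rev p) (\<lambda>i. rev (f i))"
proof (induction p)
  case (Cons x p)
  then show ?case by (cases x) (simp add: rev_pigment_act)
qed simp

lemma first1_pigment_act: "first1 (pigment_act M \<alpha> p) = pigment_act M \<alpha> (first1 p)"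
proof (induction p rule: rev_induct)
  case (snoc x p)
  then show ?case by (cases x) (simp add: first1_snoc)
qed simp

lemma vals_psup: "vals (psup M p f) = (\<Union>i\<in>vals p. vals (f i))"
proof (induction p)
  case (Cons x p)
  then show ?case by (cases x) (simp add: image_Un)
qed simp

lemma first1_psup_first1: "first1 (psup M (first1 p) f) = first1 (psup M p f)"
proof (induction p rule: rev_induct)
  case (snoc x p)
  obtain i \<alpha> where x: "x = (i, \<alpha>)" by (cases x)
  show ?case
  proof (cases "i \<in> vals p")
    case True
    have "fst y \<in> vals (psup M p f)" if "y \<in> set (first1 (pigment_act M \<alpha> (f i)))" for y
    proof -
      have "fst y \<in> vals (f i)"
        using that set_first1_subset vals_pigment_act by (metis image_eqI subsetD)
      then show ?thesis using True by (auto simp: vals_psup)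
    qed
    then have "filter (\<lambda>y. fst y \<notin> vals (psup M p f)) (first1 (pigment_act M \<alpha> (f i))) = []"
      by (simp add: filter_empty_conv)
    then show ?thesis using True snoc by (simp add: first1_snoc x first1_append)
  next
    case False
    then show ?thesis using snoc by (simp add: first1_snoc x first1_append vals_psup)
  qed
qed simp

lemma first1_psup_cong:
  assumes "first1 p = first1 p'" "\<And>i. i \<in> vals p \<Longrightarrow> first1 (f i) = first1 (g i)"
  shows "first1 (psup M p f) = first1 (psup M p' g)"
proof -
  have "first1 (psup M p f) = first1 (psup M p g)"
    using assms(2)
  proof (induction p rule: rev_induct)
    case (snoc x p)
    obtain i \<alpha> where x: "x = (i, \<alpha>)" by (cases x)
    \<comment> \<open>The filter in \<open>first1_append\<close> depends on values only, and
      \<open>first1\<close> determines these.\<close>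
    have "vals (f j) = vals (g j)" if "j \<in> vals (p @ [x])" for j
      using snoc.prems[OF that] vals_first1 by metis
    then have "vals (psup M p f) = vals (psup M p g)"
      by (simp add: vals_psup)
    then show ?case
      using snoc x by (simp add: first1_append first1_pigment_act)
  qed simp
  then show ?thesis
    using assms(1) first1_psup_first1 by metis
qed

lemma first1R_psup_cong:
  assumes "first1R p = first1R p'" "\<And>i. i \<in> vals p \<Longrightarrow> first1R (f i) = first1R (g i)"
  shows "first1R (psup M p f) = first1R (psup M p' g)"
proof -
  have "first1 (psup M (rev p) (\<lambda>i. rev (f i))) = first1 (psup M (rev p') (\<lambda>i. rev (g i)))"
    using assms by (intro first1_psup_cong) (simp_all add: first1R_conv_rev)
  then show ?thesis by (simp add: first1R_conv_rev rev_psup)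
qed

lemma mset_psup_cong:
  assumes "mset p = mset p'" "\<And>i. i \<in> vals p \<Longrightarrow> mset (f i) = mset (g i)"
  shows "mset (psup M p f) = mset (psup M p' g)"
proof -
  \<comment> \<open>Written as a sum over the multiset of letters, the result visibly does not
    depend on their order.\<close>
  have sum: "mset (psup M q h) =
      (\<Sum>(i, \<alpha>)\<in>#mset q. image_mset (\<lambda>(j, \<beta>). (j, \<alpha> \<otimes>\<^bsub>M\<^esub> \<beta>)) (mset (h i)))" for q h
  proof (induction q)
    case (Cons x q)
    then show ?case by (cases x) (simp add: pigment_act_def)
  qed simp
  have "mset (f (fst x)) = mset (g (fst x))" if "x \<in># mset p'" for x
  proof -
    have "fst x \<in> vals p" using that by (metis assms(1) image_eqI set_mset_mset)
    then show ?thesis by (rule assms(2))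
  qed
  then show ?thesis
    unfolding sum assms(1) case_prod_unfold
    by (intro arg_cong[where f = sum_mset] image_mset_cong) simp
qed

section \<open>Connecting equivalent words by adjacent exchanges\<close>

text \<open>Which letters of \<open>w\<close> survive depends on the rest only through its values.
  The analogue for \<open>first1\<close> fails, because \<open>w\<close> hides letters of the
  rest.\<close>

lemma first1R_append_cancel:
  assumes "vals q = vals q'"
  shows "first1R (w @ q) = first1R (w @ q') \<longleftrightarrow> first1R q = first1R q'"
  unfolding first1R_append assms by simp

section \<open>Letters standing before the next letter of the target word\<close>

lemma filter_vals_empty_first1:
  "filter (\<lambda>x. fst x \<notin> V) (first1 r) = [] \<longleftrightarrow> vals r \<subseteq> V"
proof -
  have "filter (\<lambda>x. fst x \<notin> V) (first1 r) = [] \<longleftrightarrow> vals (first1 r) \<subseteq> V"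
    unfolding filter_empty_conv by blast
  then show ?thesis by simp
qed

lemma filter_vals_empty_first1R:
  "filter (\<lambda>x. fst x \<notin> V) (first1R r) = [] \<longleftrightarrow> vals r \<subseteq> V"
  using filter_vals_empty_first1[of V "rev r"]
  unfolding first1R_conv_rev rev_filter[symmetric] by simp

text \<open>Behind \<open>first1 w\<close>, the next left witness of the first word is
  \<open>y\<close>. In the second word it would come from \<open>r\<close> if \<open>r\<close> had a
  value new to \<open>w\<close>, but \<open>y\<close> is not a letter of \<open>r\<close>.\<close>

lemma vals_before_first_witness:
  assumes eq: "first1 (w @ y # q) = first1 (w @ r @ y # s)"
    and y: "y \<notin> set r" "fst y \<notin> vals w"
  shows "vals r \<subseteq> vals w"
proof (rule ccontr)
  \<comment> \<open>The left witnesses that \<open>r\<close> contributes after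
    \<open>w\<close>.\<close>
  define F where "F = filter (\<lambda>x. fst x \<notin> vals w) (first1 r)"
  assume "\<not> vals r \<subseteq> vals w"
  then have ne: "F \<noteq> []"
    unfolding F_def filter_vals_empty_first1 .
  have "y # filter (\<lambda>x. fst x \<notin> vals w) (filter (\<lambda>x. fst x \<noteq> fst y) (first1 q)) =
      F @ filter (\<lambda>x. fst x \<notin> vals w) (filter (\<lambda>x. fst x \<notin> vals r) (first1 (y # s)))"
    using eq y(2) unfolding F_def first1_append[of w] first1_append[of r] first1_Cons[of y q] by simp
  then have "hd F = y"
    using ne by (metis hd_append2 list.sel(1))
  then have "y \<in> set (first1 r)"
    using hd_in_set[OF ne] by (simp add: F_def)
  then show False
    using y(1) set_first1_subset by blast
qed

text \<open>This is not the mirror image of the previous lemma: \<open>y\<close> is again at the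
  front, while right witnesses are decided from the end. The multisets are used to exclude that a
  later letter of \<open>q\<close> hides \<open>y\<close>.\<close>

lemma vals_before_last_witness:
  assumes eq: "first1R (y # q) = first1R (r @ y # s)" and mset: "mset (y # q) = mset (r @ y # s)"
    and y: "y \<notin> set r" "fst y \<notin> vals s"
  shows "vals r \<subseteq> vals s"
proof -
  define F where "F = filter (\<lambda>x. fst x \<notin> insert (fst y) (vals s)) (first1R r)"
  have R: "first1R (r @ y # s) = F @ y # first1R s"
    using y(2) by (simp add: first1R_append F_def)
  have "mset q = mset (r @ s)" using mset by simp
  then have set_q: "set q = set r \<union> set s" by (metis set_append set_mset_mset)
  \<comment> \<open>If \<open>y\<close> were hidden in the first word, equality of the witness words
    would force \<open>y\<close> itself to be a letter of \<open>q\<close>, hence of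
    \<open>r\<close> or \<open>s\<close>, and both are excluded.\<close>
  have yq: "fst y \<notin> vals q"
  proof
    assume "fst y \<in> vals q"
    then have "y \<in> set (first1R q)" using eq R by simp
    then have "y \<in> set q" using set_first1R_subset by blast
    then show False using y set_q by blast
  qed
  \<comment> \<open>Now \<open>y\<close> heads the first witness word, so no right witness from
    \<open>r\<close> can precede it in the second.\<close>
  have "F = []"
  proof (rule ccontr)
    assume ne: "F \<noteq> []"
    have "y # first1R q = F @ y # first1R s" using eq R yq by simp
    then have "hd F = y" using ne by (metis hd_append2 list.sel(1))
    then have "y \<in> set (first1R r)" using hd_in_set[OF ne] by (simp add: F_def)
    then show False using y(1) set_first1R_subset by blast
  qed
  then have "vals r \<subseteq> insert (fst y) (vals s)"
    unfolding F_def filter_vals_empty_first1R .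
  moreover have "fst y \<notin> vals r"
    using yq by (simp add: set_q image_Un)
  ultimately show ?thesis by (simp add: subset_insert)
qed

text \<open>Either \<open>w\<close> already contains the value of \<open>y\<close>, and
  \<open>y\<close> is neither a witness nor hides anything more, or \<open>w\<close> hides all of
  \<open>r\<close>. The lemma after this one is the same dichotomy with \<open>s\<close> in place of
  \<open>w\<close>.\<close>

lemma first1_move_left:
  assumes "fst y \<notin> vals w \<Longrightarrow> vals r \<subseteq> vals w"
  shows "first1 (w @ y # r @ s) = first1 (w @ r @ y # s)"
proof (cases "fst y \<in> vals w")
  case True
  then have "fst x \<noteq> fst y \<and> fst x \<notin> vals w \<longleftrightarrow> fst x \<notin> vals w"
    "fst x \<noteq> fst y \<and> Q \<and> fst x \<notin> vals w \<longleftrightarrow> Q \<and> fst x \<notin> vals w" for x :: "nat \<times> 'a" and Q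
    by metis+
  then show ?thesis using True
    by (simp add: first1_append)
next
  case False
  have "filter (\<lambda>x. fst x \<notin> vals w) (first1 r) = []"
    using assms[OF False] by (simp add: filter_vals_empty_first1)
  moreover from this have "filter (\<lambda>x. fst x \<noteq> fst y \<and> fst x \<notin> vals w) (first1 r) = []"
    by (simp add: filter_empty_conv)
  moreover have "fst y \<notin> vals r" using assms[OF False] False by (rule contra_subsetD)
  ultimately show ?thesis using False
    by (simp add: first1_append conj_ac)
qed

lemma first1R_move_left:
  assumes "fst y \<notin> vals s \<Longrightarrow> vals r \<subseteq> vals s"
  shows "first1R (y # r @ s) = first1R (r @ y # s)"
proof (cases "fst y \<in> vals s")
  case True
  then show ?thesis by (simp add: first1R_append image_Un insert_absorb)
next
  case False
  have "filter (\<lambda>x. fst x \<notin> vals s) (first1R r) = []"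
    using assms[OF False] by (simp add: filter_vals_empty_first1R)
  moreover from this have "filter (\<lambda>x. fst x \<noteq> fst y \<and> fst x \<notin> vals s) (first1R r) = []"
    by (simp add: filter_empty_conv)
  moreover have "fst y \<notin> vals r" using assms[OF False] False by (rule contra_subsetD)
  ultimately show ?thesis using False
    by (simp add: first1R_append image_Un)
qed

text \<open>The word \<open>w\<close> is the part of both words that already agrees. The head \<open>y\<close> of \<open>q\<close> is moved
  leftwards in \<open>q'\<close> from its first occurrence there; the exchanges needed never swap two left or
  two right witnesses.\<close>

lemma pill_words_connected:
  assumes swap: "\<And>w z y s. \<lbrakk>w \<in> lists A; s \<in> lists A; z \<in> A; y \<in> A;
        fst y \<in> vals w \<or> fst z \<in> vals w; fst y \<in> vals s \<or> fst z \<in> vals s\<rbrakk>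
        \<Longrightarrow> E (w @ z # y # s) (w @ y # z # s)"
    and refl: "\<And>w. w \<in> lists A \<Longrightarrow> E w w"
    and trans: "\<And>u v w. E u v \<Longrightarrow> E v w \<Longrightarrow> E u w"
    and "w \<in> lists A" "q \<in> lists A" "q' \<in> lists A"
    and "mset q = mset q'" "first1 (w @ q) = first1 (w @ q')" "first1R (w @ q) = first1R (w @ q')"
  shows "E (w @ q') (w @ q)"
  using assms(4-)
proof (induction q arbitrary: w q')
  case Nil
  then show ?case by (simp add: refl)
next
  case (Cons y q)
  have "y \<in> set q'" using Cons.prems(4) by (metis list.set_intros(1) set_mset_mset)
  \<comment> \<open>Splitting at the first occurrence ensures that \<open>y\<close> is not in
    \<open>r\<close>, as both lemmas on preceding letters require.\<close>
  then obtain r s where q': "q' = r @ y # s" and yr: "y \<notin> set r"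
    by (meson split_list_first)
  have w: "w \<in> lists A" and y: "y \<in> A" and q: "q \<in> lists A" and r: "r \<in> lists A" and s: "s \<in> lists A"
    using Cons.prems(1-3) q' by simp_all
  have mset: "mset (y # q) = mset (r @ y # s)" using Cons.prems(4) q' by simp
  have "vals (y # q) = vals (r @ y # s)" using mset by (metis set_mset_mset)
  then have R: "first1R (y # q) = first1R (r @ y # s)"
    using Cons.prems(6) first1R_append_cancel unfolding q' by blast
  have L: "first1 (w @ y # q) = first1 (w @ r @ y # s)" using Cons.prems(5) q' by simp
  have left: "vals r \<subseteq> vals w" if "fst y \<notin> vals w"
    using L yr that by (rule vals_before_first_witness)
  have right: "vals r \<subseteq> vals s" if "fst y \<notin> vals s"
    using R mset yr that by (rule vals_before_last_witness)
  \<comment> \<open>The letters of \<open>r'\<close> are still to be crossed and those of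
    \<open>r''\<close> have been crossed; \<open>rev_induct\<close> removes the letter of
    \<open>r'\<close> adjacent to \<open>y\<close>.\<close>
  have bubble: "E (w @ r' @ y # r'' @ s) (w @ y # r' @ r'' @ s)" if "r = r' @ r''" for r' r''
    using that
  proof (induction r' arbitrary: r'' rule: rev_induct)
    case Nil
    then show ?case using w y r s by (simp add: refl)
  next
    case (snoc z r')
    then have "fst z \<in> vals r" by simp
    \<comment> \<open>If the value of \<open>y\<close> is missing on one side, then every value of
      \<open>r\<close>, in particular that of \<open>z\<close>, is present there.\<close>
    then have "fst y \<in> vals w \<or> fst z \<in> vals w" "fst y \<in> vals s \<or> fst z \<in> vals s"
      using left right by blast+
    then have "E ((w @ r') @ z # y # r'' @ s) ((w @ r') @ y # z # r'' @ s)"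
      using w y r s snoc.prems by (intro swap) (simp_all add: image_Un, blast+)
    moreover have "E (w @ r' @ y # (z # r'') @ s) (w @ y # r' @ (z # r'') @ s)"
      using snoc.prems by (intro snoc.IH) simp
    ultimately show ?case by (auto intro: trans)
  qed
  \<comment> \<open>With \<open>y\<close> in place it joins the prefix; moving it changed no witness
    word, so the hypotheses carry over to \<open>q\<close> and \<open>r @ s\<close>.\<close>
  have "E ((w @ [y]) @ r @ s) ((w @ [y]) @ q)"
  proof (rule Cons.IH)
    show "first1 ((w @ [y]) @ q) = first1 ((w @ [y]) @ r @ s)"
      using L first1_move_left[of y w r s] left by simp
    have "first1R (y # q) = first1R (y # r @ s)"
      using R first1R_move_left[of y s r] right by simp
    moreover have "vals (y # q) = vals (y # r @ s)"
      using mset by (metis mset_append mset.simps(2) union_mset_add_mset_right set_mset_mset append_Cons)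
    ultimately show "first1R ((w @ [y]) @ q) = first1R ((w @ [y]) @ r @ s)"
      using first1R_append_cancel[of "y # q" "y # r @ s" w] by simp
  qed (use w y q r s mset in simp_all)
  then show ?case using bubble[of r "[]"] q' by (auto intro: trans)
qed

section \<open>Quotients and pullbacks of clone congruences\<close>

lemma clone_congruence_equiv: "clone_congruence C R \<Longrightarrow> equiv (elems C n) (R n)"
  by (simp add: clone_congruence_def)

lemma clone_congruence_superpos:
  "\<lbrakk>clone_congruence C R; (x, x') \<in> R n; length ys = n; list_all2 (\<lambda>y y'. (y, y') \<in> R m) ys ys'\<rbrakk>
    \<Longrightarrow> (superpos C n m x ys, superpos C n m x' ys') \<in> R m"
  unfolding clone_congruence_def by blast

lemma clone_congruence_refl:
  "clone_congruence C R \<Longrightarrow> x \<in> elems C n \<Longrightarrow> (x, x) \<in> R n"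
  by (meson clone_congruence_equiv equivE refl_onD)

lemma clone_congruence_sym:
  "clone_congruence C R \<Longrightarrow> (x, y) \<in> R n \<Longrightarrow> (y, x) \<in> R n"
  by (meson clone_congruence_equiv equivE symD)

lemma clone_congruence_trans:
  "clone_congruence C R \<Longrightarrow> (x, y) \<in> R n \<Longrightarrow> (y, z) \<in> R n \<Longrightarrow> (x, z) \<in> R n"
  by (meson clone_congruence_equiv equivE transD)

lemma clone_congruence_list_refl:
  "clone_congruence C R \<Longrightarrow> ys \<in> tuples C n m \<Longrightarrow> list_all2 (\<lambda>y y'. (y, y') \<in> R m) ys ys"
  by (auto simp: tuples_def list_all2_same intro: clone_congruence_refl)

lemma in_listset_conv: "ys \<in> listset Ys \<longleftrightarrow> list_all2 (\<in>) ys Ys"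
  by (induction Ys arbitrary: ys) (auto simp: set_Cons_def list_all2_Cons2)

text \<open>For a congruence the union defining the quotient operation runs over a constant family,
  and reflexivity makes its index sets nonempty.\<close>

lemma quotient_superpos:
  assumes R: "clone_congruence C R" and x: "x \<in> elems C n" and ys: "ys \<in> tuples C n m"
  shows "superpos (quotient_clone C R) n m (R n `` {x}) (map (\<lambda>y. R m `` {y}) ys) =
    R m `` {superpos C n m x ys}"
proof -
  have eq: "R m `` {superpos C n m x' ys'} = R m `` {superpos C n m x ys}"
    if "x' \<in> R n `` {x}" "ys' \<in> listset (map (\<lambda>y. R m `` {y}) ys)" for x' ys'
  proof -
    have "list_all2 (\<lambda>y y'. (y, y') \<in> R m) ys ys'"
      using that(2) by (auto simp: in_listset_conv list_all2_conv_all_nth)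
    then have "(superpos C n m x ys, superpos C n m x' ys') \<in> R m"
      using that(1) ys by (auto intro!: clone_congruence_superpos[OF R] simp: tuples_def)
    then show ?thesis
      using equiv_class_eq[OF clone_congruence_equiv[OF R]] by metis
  qed
  have x_in: "x \<in> R n `` {x}"
    using clone_congruence_refl[OF R x] by simp
  have ys_in: "ys \<in> listset (map (\<lambda>y. R m `` {y}) ys)"
    using clone_congruence_list_refl[OF R ys] by (auto simp: in_listset_conv list_all2_conv_all_nth)
  have "(\<Union>x'\<in>R n `` {x}. \<Union>ys'\<in>listset (map (\<lambda>y. R m `` {y}) ys). R m `` {superpos C n m x' ys'}) =
      R m `` {superpos C n m x ys}"
    by (intro ballI UN_constant_eq[OF x_in] UN_constant_eq[OF ys_in] eq)
  then show ?thesis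
    unfolding quotient_clone_def clone.simps .
qed

lemma quotient_elemE:
  assumes "X \<in> elems (quotient_clone C R) n"
  obtains x where "x \<in> elems C n" "X = R n `` {x}"
  using assms by (auto simp: quotient_clone_def elim: quotientE)

lemma quotient_elemI: "x \<in> elems C n \<Longrightarrow> R n `` {x} \<in> elems (quotient_clone C R) n"
  by (simp add: quotient_clone_def quotientI)

lemma quotient_tupleE:
  assumes "Ys \<in> tuples (quotient_clone C R) n m"
  obtains ys where "ys \<in> tuples C n m" "Ys = map (\<lambda>y. R m `` {y}) ys"
proof -
  have "\<forall>Y\<in>set Ys. \<exists>y. y \<in> elems C m \<and> Y = R m `` {y}"
    using assms unfolding tuples_def by (blast elim: quotient_elemE)
  then obtain f where f: "\<And>Y. Y \<in> set Ys \<Longrightarrow> f Y \<in> elems C m \<and> Y = R m `` {f Y}"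
    by metis
  show ?thesis
  proof (rule that)
    show "map f Ys \<in> tuples C n m" using f assms by (auto simp: tuples_def)
    show "Ys = map (\<lambda>y. R m `` {y}) (map f Ys)"
      using f by (auto intro!: map_idI[symmetric] simp: comp_def)
  qed
qed

lemma clone_quotient_clone:
  assumes C: "clone C" and R: "clone_congruence C R"
  shows "clone (quotient_clone C R)"
proof -
  interpret clone C by fact
  note sup = quotient_superpos[OF R]
  have proj: "projection (quotient_clone C R) i n = R n `` {projection C i n}" for i n
    by (simp add: quotient_clone_def)
  show ?thesis
  proof
    fix X n Ys m
    assume "X \<in> elems (quotient_clone C R) n" "Ys \<in> tuples (quotient_clone C R) n m"
    then show "superpos (quotient_clone C R) n m X Ys \<in> elems (quotient_clone C R) m"
      by (elim quotient_elemE quotient_tupleE) (simp add: sup superpos_closed quotient_elemI)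
  next
    fix i n :: nat
    assume "1 \<le> i" "i \<le> n"
    then show "projection (quotient_clone C R) i n \<in> elems (quotient_clone C R) n"
      by (simp add: proj projection_closed quotient_elemI)
  next
    fix i n Ys m
    assume i: "1 \<le> i" "i \<le> n" and Ys: "Ys \<in> tuples (quotient_clone C R) n m"
    from Ys obtain ys where ys: "ys \<in> tuples C n m" "Ys = map (\<lambda>y. R m `` {y}) ys"
      by (rule quotient_tupleE)
    then show "superpos (quotient_clone C R) n m (projection (quotient_clone C R) i n) Ys = Ys ! (i - 1)"
      using i by (simp add: proj sup projection_closed projection_superpos) (simp add: tuples_def)
  next
    fix X n
    assume "X \<in> elems (quotient_clone C R) n"
    then obtain x where x: "x \<in> elems C n" "X = R n `` {x}"
      by (rule quotient_elemE)
    have "map (\<lambda>i. projection C i n) [1..<Suc n] \<in> tuples C n n"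
      by (auto simp: tuples_def projection_closed simp del: upt_Suc)
    from sup[OF x(1) this]
    show "superpos (quotient_clone C R) n n X
        (map (\<lambda>i. projection (quotient_clone C R) i n) [1..<Suc n]) = X"
      using x by (simp add: proj comp_def superpos_projections del: upt_Suc One_nat_def)
  next
    fix X n Ys m Zs k
    assume "X \<in> elems (quotient_clone C R) n" "Ys \<in> tuples (quotient_clone C R) n m"
      "Zs \<in> tuples (quotient_clone C R) m k"
    then obtain x ys zs where x: "x \<in> elems C n" "X = R n `` {x}"
      and ys: "ys \<in> tuples C n m" "Ys = map (\<lambda>y. R m `` {y}) ys"
      and zs: "zs \<in> tuples C m k" "Zs = map (\<lambda>y. R k `` {y}) zs"
      by (elim quotient_elemE quotient_tupleE)
    have yk: "map (\<lambda>y. superpos C m k y zs) ys \<in> tuples C n k"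
      using ys zs by (auto simp: tuples_def intro!: superpos_closed)
    have "map (\<lambda>Y. superpos (quotient_clone C R) m k Y Zs) Ys =
        map (\<lambda>y. R k `` {y}) (map (\<lambda>y. superpos C m k y zs) ys)"
      using ys zs by (auto simp: sup tuples_def)
    then show "superpos (quotient_clone C R) m k (superpos (quotient_clone C R) n m X Ys) Zs =
        superpos (quotient_clone C R) n k X (map (\<lambda>Y. superpos (quotient_clone C R) m k Y Zs) Ys)"
      using x ys zs by (simp add: sup superpos_closed sup[OF _ yk] superpos_assoc del: map_map)
  qed
qed

text \<open>In contrast to \<open>clone_iso\<close>, a single function serves all arities, as fits
  an evaluation map on terms, which carry no arity of their own.\<close>

definition clone_hom :: "'a clone \<Rightarrow> 'b clone \<Rightarrow> ('a \<Rightarrow> 'b) \<Rightarrow> bool" where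
  "clone_hom C D f \<longleftrightarrow>
    (\<forall>n. f ` elems C n \<subseteq> elems D n) \<and>
    (\<forall>i n. 1 \<le> i \<longrightarrow> i \<le> n \<longrightarrow> f (projection C i n) = projection D i n) \<and>
    (\<forall>n m. \<forall>x\<in>elems C n. \<forall>ys\<in>tuples C n m.
      f (superpos C n m x ys) = superpos D n m (f x) (map f ys))"

text \<open>The kernel of the composite of \<open>f\<close> with the quotient map of
  \<open>D\<close> by \<open>R\<close>, arity by arity.\<close>

definition pullback_rel ::
    "'a clone \<Rightarrow> ('a \<Rightarrow> 'b) \<Rightarrow> (nat \<Rightarrow> ('b \<times> 'b) set) \<Rightarrow> nat \<Rightarrow> ('a \<times> 'a) set" where
  "pullback_rel C f R n = {(x, y). x \<in> elems C n \<and> y \<in> elems C n \<and> (f x, f y) \<in> R n}"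

lemma pullback_congruence:
  assumes C: "clone C" and f: "clone_hom C D f" and R: "clone_congruence D R"
  shows "clone_congruence C (pullback_rel C f R)"
  unfolding clone_congruence_def
proof (intro conjI allI impI)
  fix n
  show "equiv (elems C n) (pullback_rel C f R n)"
  proof (rule equivI)
    show "pullback_rel C f R n \<subseteq> elems C n \<times> elems C n"
      by (auto simp: pullback_rel_def)
    show "refl_on (elems C n) (pullback_rel C f R n)"
      using f clone_congruence_refl[OF R] by (fastforce simp: pullback_rel_def clone_hom_def refl_on_def)
    show "sym (pullback_rel C f R n)"
      using clone_congruence_sym[OF R] by (auto simp: pullback_rel_def sym_def)
    show "trans (pullback_rel C f R n)"
      using clone_congruence_trans[OF R] by (fastforce simp: pullback_rel_def trans_def)
  qed
next
  fix n m x x' ys ys'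
  assume x: "(x, x') \<in> pullback_rel C f R n" and n: "length ys = n"
    and ys: "list_all2 (\<lambda>y y'. (y, y') \<in> pullback_rel C f R m) ys ys'"
  have T: "ys \<in> tuples C n m" "ys' \<in> tuples C n m"
    using n ys by (auto simp: tuples_def pullback_rel_def list_all2_conv_all_nth in_set_conv_nth)
  have "list_all2 (\<lambda>y y'. (y, y') \<in> R m) (map f ys) (map f ys')"
    using ys by (auto simp: list_all2_conv_all_nth pullback_rel_def)
  then have "(superpos D n m (f x) (map f ys), superpos D n m (f x') (map f ys')) \<in> R m"
    using x n by (intro clone_congruence_superpos[OF R]) (auto simp: pullback_rel_def)
  then show "(superpos C n m x ys, superpos C n m x' ys') \<in> pullback_rel C f R m"
    using x T f clone.superpos_closed[OF C] by (auto simp: pullback_rel_def clone_hom_def)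
qed

text \<open>The first isomorphism theorem for clones, stated in the direction that
  \<open>presentation_of\<close> demands.\<close>

lemma pullback_quotient_iso:
  assumes C: "clone C" and D: "clone D" and f: "clone_hom C D f" and R: "clone_congruence D R"
    and surj: "\<And>n. f ` elems C n = elems D n"
  shows "clone_isomorphic (quotient_clone D R) (quotient_clone C (pullback_rel C f R))"
proof -
  define K where "K = pullback_rel C f R"
  have K: "clone_congruence C K"
    unfolding K_def using C f R by (rule pullback_congruence)
  \<comment> \<open>Taking preimages of classes needs no choice of representatives, so
    well-definedness is no issue; \<open>cls\<close> computes the map on the class of
    \<open>f x\<close>.\<close>
  define \<phi> where "\<phi> n X = {x \<in> elems C n. f x \<in> X}" for n X
  have cls: "\<phi> n (R n `` {f x}) = K n `` {x}" if "x \<in> elems C n" for n x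
    using that by (auto simp: \<phi>_def K_def pullback_rel_def)
  have lift: "\<exists>x\<in>elems C n. X = R n `` {f x}" if X: "X \<in> elems (quotient_clone D R) n" for n X
  proof -
    obtain d where "d \<in> elems D n" "X = R n `` {d}" using X by (rule quotient_elemE)
    then show ?thesis using surj[of n] by (metis imageE)
  qed
  have lifts: "\<exists>xs\<in>tuples C n m. Xs = map (\<lambda>x. R m `` {f x}) xs"
    if "Xs \<in> tuples (quotient_clone D R) n m" for n m Xs
  proof -
    have "\<forall>X\<in>set Xs. \<exists>x. x \<in> elems C m \<and> X = R m `` {f x}"
      using that lift unfolding tuples_def by blast
    then obtain g where g: "\<And>X. X \<in> set Xs \<Longrightarrow> g X \<in> elems C m \<and> X = R m `` {f (g X)}"
      by metis
    have "map g Xs \<in> tuples C n m" using g that by (auto simp: tuples_def)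
    moreover have "Xs = map (\<lambda>x. R m `` {f x}) (map g Xs)"
      using g by (auto intro!: map_idI[symmetric] simp: comp_def)
    ultimately show ?thesis by blast
  qed
  have "bij_betw (\<phi> n) (elems (quotient_clone D R) n) (elems (quotient_clone C K) n)" for n
  proof (rule bij_betw_imageI)
    show "inj_on (\<phi> n) (elems (quotient_clone D R) n)"
    proof (rule inj_onI)
      fix X Y
      assume "X \<in> elems (quotient_clone D R) n" "Y \<in> elems (quotient_clone D R) n"
        and eq: "\<phi> n X = \<phi> n Y"
      then obtain x y where x: "x \<in> elems C n" "X = R n `` {f x}"
        and y: "y \<in> elems C n" "Y = R n `` {f y}"
        using lift by meson
      then have "K n `` {x} = K n `` {y}" using eq cls by simp
      then have "(x, y) \<in> K n"
        by (rule eq_equiv_class[OF _ clone_congruence_equiv[OF K] y(1)])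
      then show "X = Y"
        using x y equiv_class_eq[OF clone_congruence_equiv[OF R]]
        by (simp add: K_def pullback_rel_def)
    qed
    show "\<phi> n ` elems (quotient_clone D R) n = elems (quotient_clone C K) n"
    proof (intro equalityI subsetI)
      fix Z assume "Z \<in> \<phi> n ` elems (quotient_clone D R) n"
      then obtain x where "x \<in> elems C n" "Z = \<phi> n (R n `` {f x})" using lift by blast
      then show "Z \<in> elems (quotient_clone C K) n" by (simp add: cls quotient_elemI)
    next
      fix Z assume "Z \<in> elems (quotient_clone C K) n"
      then obtain x where "x \<in> elems C n" "Z = K n `` {x}" by (rule quotient_elemE)
      moreover from this have "R n `` {f x} \<in> elems (quotient_clone D R) n"
        using surj by (intro quotient_elemI) blast
      ultimately show "Z \<in> \<phi> n ` elems (quotient_clone D R) n"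
        using cls by (metis image_eqI)
    qed
  qed
  moreover have "\<phi> n (projection (quotient_clone D R) i n) = projection (quotient_clone C K) i n"
    if "1 \<le> i" "i \<le> n" for i n
    using that f cls[OF clone.projection_closed[OF C that]]
    by (simp add: quotient_clone_def clone_hom_def)
  moreover have "\<phi> m (superpos (quotient_clone D R) n m X Ys) =
      superpos (quotient_clone C K) n m (\<phi> n X) (map (\<phi> m) Ys)"
    if XY: "X \<in> elems (quotient_clone D R) n" "Ys \<in> tuples (quotient_clone D R) n m" for n m X Ys
  proof -
    obtain x where x: "x \<in> elems C n" "X = R n `` {f x}" using lift XY by blast
    obtain ys where ys: "ys \<in> tuples C n m" "Ys = map (\<lambda>x. R m `` {f x}) ys"
      using lifts XY by blast
    have "f x \<in> elems D n" "map f ys \<in> tuples D n m"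
      using x ys surj by (auto simp: tuples_def)
    then have "superpos (quotient_clone D R) n m X Ys = R m `` {superpos D n m (f x) (map f ys)}"
      using quotient_superpos[OF R] x ys by (fastforce simp: comp_def)
    also have "superpos D n m (f x) (map f ys) = f (superpos C n m x ys)"
      using f x ys by (simp add: clone_hom_def)
    finally have "\<phi> m (superpos (quotient_clone D R) n m X Ys) = K m `` {superpos C n m x ys}"
      using cls clone.superpos_closed[OF C] x ys by simp
    moreover have "map (\<phi> m) Ys = map (\<lambda>y. K m `` {y}) ys"
      using ys cls by (auto simp: tuples_def)
    ultimately show ?thesis
      using quotient_superpos[OF K x(1) ys(1)] x cls by simp
  qed
  ultimately show ?thesis
    unfolding clone_isomorphic_def clone_iso_def K_def by blast
qed

section \<open>Generated equivalences and the clone of terms\<close>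

lemma in_generated_equiv:
  "(x, y) \<in> generated_equiv A R n \<longleftrightarrow> (\<forall>E. equiv (A n) E \<longrightarrow> R n \<subseteq> E \<longrightarrow> (x, y) \<in> E)"
  by (auto simp: generated_equiv_def)

lemma generated_equiv_equiv:
  assumes "R n \<subseteq> A n \<times> A n"
  shows "equiv (A n) (generated_equiv A R n)"
proof -
  \<comment> \<open>The total relation shows that the intersected family is not empty; this bounds
    the intersection by \<open>A n \<times> A n\<close>.\<close>
  have full: "equiv (A n) (A n \<times> A n)"
    by (auto intro!: equivI simp: refl_on_def sym_def trans_def)
  show ?thesis
  proof (rule equivI)
    show "generated_equiv A R n \<subseteq> A n \<times> A n"
      using full assms by (auto simp: generated_equiv_def)
    show "refl_on (A n) (generated_equiv A R n)"
      unfolding refl_on_def in_generated_equiv by (meson equivE refl_onD)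
    show "sym (generated_equiv A R n)"
      unfolding sym_def in_generated_equiv by (meson equivE symD)
    show "trans (generated_equiv A R n)"
      unfolding trans_def in_generated_equiv by (meson equivE transD)
  qed
qed

lemma generated_equiv_incl: "R n \<subseteq> generated_equiv A R n"
  by (auto simp: generated_equiv_def)

lemma generated_equiv_least: "equiv (A n) E \<Longrightarrow> R n \<subseteq> E \<Longrightarrow> generated_equiv A R n \<subseteq> E"
  by (auto simp: generated_equiv_def)

lemma clone_term_clone: "clone (term_clone G)"
proof -
  have closed: "tm_subst ts t \<in> terms G m"
    if "t \<in> terms G n" "length ts = n" "set ts \<subseteq> terms G m" for n m t ts
    using that by (induction rule: terms.induct) (auto intro!: terms.App)
  have assoc: "tm_subst us (tm_subst ts t) = tm_subst (map (tm_subst us) ts) t"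
    if "t \<in> terms G n" "length ts = n" for n t and ts us :: "'a tm list"
    using that by (induction rule: terms.induct) auto
  have ident: "tm_subst (map Var [1..<Suc n]) t = t" if "t \<in> terms G n" for n t
    using that by (induction rule: terms.induct) (auto simp: map_idI simp del: upt_Suc)
  show ?thesis
    by standard (auto simp: term_clone_def tuples_def closed assoc ident terms.Var simp del: upt_Suc One_nat_def)
qed

section \<open>The clone of pigmented words\<close>

lemma elems_pword_clone [simp]: "elems (pword_clone M) = pwords M"
  by (simp add: pword_clone_def)

lemma superpos_pword_clone [simp]:
  "superpos (pword_clone M) n m p qs = psup M p (\<lambda>i. qs ! (i - 1))"
  by (simp add: pword_clone_def psup_def)

lemma pwords_simps [simp]:
  "[] \<in> pwords M n"
  "(i, \<alpha>) # p \<in> pwords M n \<longleftrightarrow> 1 \<le> i \<and> i \<le> n \<and> \<alpha> \<in> carrier M \<and> p \<in> pwords M n"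
  "p @ q \<in> pwords M n \<longleftrightarrow> p \<in> pwords M n \<and> q \<in> pwords M n"
  by (auto simp: pwords_def)

lemma pwords_induct [consumes 1, case_names Nil Cons]:
  assumes "p \<in> pwords M n" "P []"
    and "\<And>i \<alpha> p. \<lbrakk>1 \<le> i; i \<le> n; \<alpha> \<in> carrier M; p \<in> pwords M n; P p\<rbrakk> \<Longrightarrow> P ((i, \<alpha>) # p)"
  shows "P p"
  using assms(1)
proof (induction p)
  case (Cons x p)
  then show ?case by (cases x) (simp add: assms(3))
qed (rule assms(2))

lemma vals_pwords: "p \<in> pwords M n \<Longrightarrow> i \<in> vals p \<Longrightarrow> 1 \<le> i \<and> i \<le> n"
  by (induction rule: pwords_induct) auto

lemma (in monoid) pigment_act_closed [simp]:
  assumes "\<alpha> \<in> carrier G" "p \<in> pwords G n"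
  shows "pigment_act G \<alpha> p \<in> pwords G n"
  using assms(2) by (induction rule: pwords_induct) (simp_all add: assms(1))

lemma (in monoid) pigment_act_one [simp]:
  "p \<in> pwords G n \<Longrightarrow> pigment_act G \<one> p = p"
  by (induction rule: pwords_induct) simp_all

lemma (in monoid) pigment_act_mult:
  assumes "\<alpha> \<in> carrier G" "\<beta> \<in> carrier G" "p \<in> pwords G n"
  shows "pigment_act G \<alpha> (pigment_act G \<beta> p) = pigment_act G (\<alpha> \<otimes> \<beta>) p"
  using assms(3) by (induction rule: pwords_induct) (simp_all add: assms(1,2) m_assoc)

lemma (in monoid) psup_closed:
  assumes "p \<in> pwords G n" "\<And>i. 1 \<le> i \<Longrightarrow> i \<le> n \<Longrightarrow> f i \<in> pwords G m"
  shows "psup G p f \<in> pwords G m"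
  using assms(1) by (induction rule: pwords_induct) (simp_all add: assms(2))

lemma (in monoid) psup_pigment_act:
  assumes "\<alpha> \<in> carrier G" "p \<in> pwords G n" "\<And>i. 1 \<le> i \<Longrightarrow> i \<le> n \<Longrightarrow> f i \<in> pwords G m"
  shows "psup G (pigment_act G \<alpha> p) f = pigment_act G \<alpha> (psup G p f)"
  using assms(2)
  by (induction rule: pwords_induct) (simp_all add: assms(1) pigment_act_mult[OF _ _ assms(3)])

lemma (in monoid) psup_assoc:
  assumes "p \<in> pwords G n" "\<And>i. 1 \<le> i \<Longrightarrow> i \<le> n \<Longrightarrow> f i \<in> pwords G m"
    "\<And>i. 1 \<le> i \<Longrightarrow> i \<le> m \<Longrightarrow> g i \<in> pwords G k"
  shows "psup G (psup G p f) g = psup G p (\<lambda>i. psup G (f i) g)"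
  using assms(1)
  by (induction rule: pwords_induct) (simp_all add: psup_pigment_act[OF _ assms(2,3)])

lemma (in monoid) psup_unit:
  "p \<in> pwords G n \<Longrightarrow> (\<And>i. 1 \<le> i \<Longrightarrow> i \<le> n \<Longrightarrow> f i = [(i, \<one>)]) \<Longrightarrow> psup G p f = p"
  by (induction rule: pwords_induct) simp_all

lemma psup_cong:
  "p \<in> pwords M n \<Longrightarrow> (\<And>i. 1 \<le> i \<Longrightarrow> i \<le> n \<Longrightarrow> f i = g i) \<Longrightarrow> psup M p f = psup M p g"
  by (induction rule: pwords_induct) simp_all

lemma tuples_nth: "ys \<in> tuples C n m \<Longrightarrow> 1 \<le> i \<Longrightarrow> i \<le> n \<Longrightarrow> ys ! (i - 1) \<in> elems C m"
  unfolding tuples_def by (auto simp: subset_iff)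

lemma (in monoid) clone_pword_clone: "clone (pword_clone G)"
proof
  fix x n ys m
  assume "x \<in> elems (pword_clone G) n" "ys \<in> tuples (pword_clone G) n m"
  then show "superpos (pword_clone G) n m x ys \<in> elems (pword_clone G) m"
    using tuples_nth[of ys "pword_clone G" n m] by (auto intro!: psup_closed)
next
  fix i n :: nat
  assume "1 \<le> i" "i \<le> n"
  then show "projection (pword_clone G) i n \<in> elems (pword_clone G) n"
    by (simp add: pword_clone_def)
next
  fix i n ys m
  assume "1 \<le> i" "i \<le> n" "ys \<in> tuples (pword_clone G) n m"
  then have "ys ! (i - 1) \<in> pwords G m"
    using tuples_nth[of ys "pword_clone G" n m] by simp
  then show "superpos (pword_clone G) n m (projection (pword_clone G) i n) ys = ys ! (i - 1)"
    by (simp add: pword_clone_def)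
next
  fix x n
  assume "x \<in> elems (pword_clone G) n"
  then show "superpos (pword_clone G) n n x (map (\<lambda>i. projection (pword_clone G) i n) [1..<Suc n]) = x"
    by (auto intro!: psup_unit simp: pword_clone_def[of G] psup_def[symmetric] simp del: upt_Suc)
next
  fix x n ys m zs k
  assume x: "x \<in> elems (pword_clone G) n" and ys: "ys \<in> tuples (pword_clone G) n m"
    and zs: "zs \<in> tuples (pword_clone G) m k"
  have "psup G (psup G x (\<lambda>i. ys ! (i - 1))) (\<lambda>i. zs ! (i - 1)) =
      psup G x (\<lambda>i. psup G (ys ! (i - 1)) (\<lambda>i. zs ! (i - 1)))"
    using x tuples_nth[OF ys] tuples_nth[OF zs] by (intro psup_assoc[of _ n _ m _ k]) simp_all
  also have "\<dots> = psup G x (\<lambda>i. map (\<lambda>y. psup G y (\<lambda>i. zs ! (i - 1))) ys ! (i - 1))"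
    using x ys by (intro psup_cong[of _ _ n]) (simp_all add: tuples_def)
  finally show "superpos (pword_clone G) m k (superpos (pword_clone G) n m x ys) zs =
      superpos (pword_clone G) n k x (map (\<lambda>y. superpos (pword_clone G) m k y zs) ys)"
    by simp
qed

lemma (in monoid) pill_rel_congruence: "clone_congruence (pword_clone G) (pill_rel G)"
  unfolding clone_congruence_def
proof (intro conjI allI impI)
  fix n
  show "equiv (elems (pword_clone G) n) (pill_rel G n)"
    by (auto intro!: equivI simp: pill_rel_def refl_on_def sym_def trans_def)
next
  fix n m x x' ys ys'
  assume x: "(x, x') \<in> pill_rel G n" and n: "length ys = n"
    and ys: "list_all2 (\<lambda>y y'. (y, y') \<in> pill_rel G m) ys ys'"
  define f g where "f = (\<lambda>i. ys ! (i - 1))" and "g = (\<lambda>i. ys' ! (i - 1))"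
  have fg: "(f i, g i) \<in> pill_rel G m" if "1 \<le> i" "i \<le> n" for i
    using that n ys by (simp add: f_def g_def list_all2_conv_all_nth)
  have x_in: "x \<in> pwords G n" "x' \<in> pwords G n"
    using x by (simp_all add: pill_rel_def)
  have "mset (f i) = mset (g i)" "first1 (f i) = first1 (g i)" "first1R (f i) = first1R (g i)"
    if "i \<in> vals x" for i
    using fg vals_pwords[OF x_in(1) that] by (simp_all add: pill_rel_def)
  then have "mset (psup G x f) = mset (psup G x' g)" "first1 (psup G x f) = first1 (psup G x' g)"
    "first1R (psup G x f) = first1R (psup G x' g)"
    using x by (auto simp: pill_rel_def intro!: mset_psup_cong first1_psup_cong first1R_psup_cong)
  moreover have "psup G x f \<in> pwords G m" "psup G x' g \<in> pwords G m"
    using x_in fg by (auto simp: pill_rel_def intro!: psup_closed[of _ n])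
  ultimately have "(psup G x f, psup G x' g) \<in> pill_rel G m"
    by (simp add: pill_rel_def)
  then show "(superpos (pword_clone G) n m x ys, superpos (pword_clone G) n m x' ys') \<in> pill_rel G m"
    by (simp add: f_def g_def)
qed

section \<open>Evaluation of terms\<close>

text \<open>On terms this is the clone homomorphism into \<open>P(M)\<close> induced by sending
  \<open>SymU\<close> to the empty word, \<open>SymP \<alpha>\<close> to
  \<open>[(1, \<alpha>)]\<close> and \<open>SymStar\<close> to the two-letter word with values 1, 2
  and unit pigments.\<close>

fun term_word :: "('m, 'b) monoid_scheme \<Rightarrow> 'm sym tm \<Rightarrow> 'm pword" where
  "term_word M (Var i) = [(i, \<one>\<^bsub>M\<^esub>)]"
| "term_word M (App g ts) =
    (case g of SymP \<alpha> \<Rightarrow> pigment_act M \<alpha> (concat (map (term_word M) ts))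
     | _ \<Rightarrow> concat (map (term_word M) ts))"

lemma elems_term_clone [simp]: "elems (term_clone G) = terms G"
  by (simp add: term_clone_def)

lemma superpos_term_clone [simp]: "superpos (term_clone G) n m t ts = tm_subst ts t"
  by (simp add: term_clone_def)

lemma sig_terms_induct [consumes 1, case_names Var Unit Pig Star]:
  assumes "t \<in> terms (sig M) n"
    and "\<And>i. 1 \<le> i \<Longrightarrow> i \<le> n \<Longrightarrow> P (Var i)"
    and "P unit_tm"
    and "\<And>\<alpha> t. \<alpha> \<in> carrier M \<Longrightarrow> t \<in> terms (sig M) n \<Longrightarrow> P t \<Longrightarrow> P (pig_tm \<alpha> t)"
    and "\<And>s t. s \<in> terms (sig M) n \<Longrightarrow> P s \<Longrightarrow> t \<in> terms (sig M) n \<Longrightarrow> P t \<Longrightarrow> P (star_tm s t)"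
  shows "P t"
  using assms(1)
proof (induction rule: terms.induct)
  case (Var i)
  then show ?case by (rule assms(2))
next
  case (App g ts)
  consider "ts = []" "g = SymU" | t \<alpha> where "ts = [t]" "\<alpha> \<in> carrier M" "g = SymP \<alpha>"
    | s t where "ts = [s, t]" "g = SymStar"
    using App(1) by (auto simp: sig_def length_Suc_conv numeral_2_eq_2 split: if_splits)
  then show ?case
    using App(2) by cases (auto intro: assms(3-5))
qed

lemma sig_terms_intros [simp]:
  "Var i \<in> terms (sig M) n \<longleftrightarrow> 1 \<le> i \<and> i \<le> n"
  "unit_tm \<in> terms (sig M) n"
  "pig_tm \<alpha> t \<in> terms (sig M) n \<longleftrightarrow> \<alpha> \<in> carrier M \<and> t \<in> terms (sig M) n"
  "star_tm s t \<in> terms (sig M) n \<longleftrightarrow> s \<in> terms (sig M) n \<and> t \<in> terms (sig M) n"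
  by (auto simp: sig_def intro!: terms.intros elim: terms.cases)

lemma rc_terms: "p \<in> pwords M n \<Longrightarrow> rc p \<in> terms (sig M) n"
  by (induction rule: pwords_induct) simp_all

lemma (in monoid) term_word_rc: "p \<in> pwords G n \<Longrightarrow> term_word G (rc p) = p"
  by (induction rule: pwords_induct) simp_all

lemma (in monoid) term_word_closed: "t \<in> terms (sig G) n \<Longrightarrow> term_word G t \<in> pwords G n"
  by (induction rule: sig_terms_induct) simp_all

lemma (in monoid) term_word_subst:
  assumes "t \<in> terms (sig G) n" "length ts = n" "set ts \<subseteq> terms (sig G) m"
  shows "term_word G (tm_subst ts t) = psup G (term_word G t) (\<lambda>i. term_word G (ts ! (i - 1)))"
proof -
  have ts: "term_word G (ts ! (i - 1)) \<in> pwords G m" if "1 \<le> i" "i \<le> n" for i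
    using that assms by (intro term_word_closed) (auto simp: subset_iff)
  \<comment> \<open>For the variable case: the letter that represents a variable carries the unit
    pigment and must act trivially on the word put in its place.\<close>
  then have ts': "pigment_act G \<one> (term_word G (ts ! (i - 1))) = term_word G (ts ! (i - 1))"
    if "1 \<le> i" "i \<le> n" for i
    using that pigment_act_one by blast
  show ?thesis
    using assms(1)
    by (induction rule: sig_terms_induct)
      (simp_all add: ts' psup_pigment_act[OF _ term_word_closed ts] del: One_nat_def)
qed

lemma (in monoid) term_word_hom: "clone_hom (term_clone (sig G)) (pword_clone G) (term_word G)"
  unfolding clone_hom_def
proof (intro conjI allI impI ballI)
  fix n m t ts
  assume "t \<in> elems (term_clone (sig G)) n" "ts \<in> tuples (term_clone (sig G)) n m"
  then have t: "t \<in> terms (sig G) n" and ts: "length ts = n" "set ts \<subseteq> terms (sig G) m"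
    by (simp_all add: tuples_def)
  have "psup G (term_word G t) (\<lambda>i. term_word G (ts ! (i - 1))) =
      psup G (term_word G t) (\<lambda>i. map (term_word G) ts ! (i - 1))"
    using ts by (intro psup_cong[OF term_word_closed[OF t]]) simp
  then show "term_word G (superpos (term_clone (sig G)) n m t ts) =
      superpos (pword_clone G) n m (term_word G t) (map (term_word G) ts)"
    using term_word_subst[OF t ts] by simp
qed (auto simp: term_word_closed term_clone_def pword_clone_def)

lemma (in monoid) term_word_surj: "term_word G ` terms (sig G) n = pwords G n"
proof
  show "pwords G n \<subseteq> term_word G ` terms (sig G) n"
    using rc_terms term_word_rc by (metis image_eqI subsetI)
qed (auto simp: term_word_closed)

section \<open>Soundness\<close>

lemma (in monoid) base_eqs_sound:
  assumes "(n, s, t) \<in> base_eqs G"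
  shows "s \<in> terms (sig G) n" "t \<in> terms (sig G) n" "term_word G s = term_word G t"
  using assms by (cases; simp)+

lemma (in monoid) pill_eqs_sound:
  assumes "(n, s, t) \<in> pill_eqs G"
  shows "s \<in> terms (sig G) n" "t \<in> terms (sig G) n" "(term_word G s, term_word G t) \<in> pill_rel G n"
  using assms by (cases; simp add: pill_rel_def)+

definition word_rel :: "('m, 'b) monoid_scheme \<Rightarrow> nat \<Rightarrow> ('m sym tm \<times> 'm sym tm) set" where
  "word_rel M = pullback_rel (term_clone (sig M)) (term_word M) (pill_rel M)"

lemma (in monoid) word_rel_congruence: "clone_congruence (term_clone (sig G)) (word_rel G)"
  unfolding word_rel_def
  using clone_term_clone term_word_hom pill_rel_congruence by (rule pullback_congruence)

lemma (in monoid) base_eqs_word_rel: "{(s, t). (n, s, t) \<in> base_eqs G} \<subseteq> word_rel G n"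
  using base_eqs_sound clone_congruence_refl[OF pill_rel_congruence]
  by (auto simp: word_rel_def pullback_rel_def term_word_closed)

lemma (in monoid) pill_eqs_word_rel: "{(s, t). (n, s, t) \<in> pill_eqs G} \<subseteq> word_rel G n"
  using pill_eqs_sound by (auto simp: word_rel_def pullback_rel_def)

lemma (in monoid) word_rel_equiv: "equiv (terms (sig G) n) (word_rel G n)"
  using clone_congruence_equiv[OF word_rel_congruence, of n] by simp

lemma (in monoid) pill_pres_rel_word_rel: "pill_pres_rel G n \<subseteq> word_rel G n"
  and pill_pres_rel_equiv: "equiv (terms (sig G) n) (pill_pres_rel G n)"
proof -
  have "base_rel G n \<subseteq> word_rel G n"
    unfolding base_rel_def using word_rel_equiv base_eqs_word_rel by (rule generated_equiv_least)
  then have sub: "base_rel G n \<union> {(s, t). (n, s, t) \<in> pill_eqs G} \<subseteq> word_rel G n"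
    using pill_eqs_word_rel by simp
  show "pill_pres_rel G n \<subseteq> word_rel G n"
    unfolding pill_pres_rel_def using word_rel_equiv sub by (rule generated_equiv_least)
  \<comment> \<open>The inclusion in \<open>word_rel\<close> also keeps the generating pairs inside
    the terms of arity \<open>n\<close>, as \<open>generated_equiv_equiv\<close> requires.\<close>
  have "word_rel G n \<subseteq> terms (sig G) n \<times> terms (sig G) n"
    by (auto simp: word_rel_def pullback_rel_def)
  then show "equiv (terms (sig G) n) (pill_pres_rel G n)"
    unfolding pill_pres_rel_def using sub by (intro generated_equiv_equiv) blast
qed

lemma eqs_pill_pres_rel:
  assumes "(n, s, t) \<in> base_eqs M \<or> (n, s, t) \<in> pill_eqs M"
  shows "(s, t) \<in> pill_pres_rel M n"
proof -
  have "(s, t) \<in> base_rel M n \<union> {(s, t). (n, s, t) \<in> pill_eqs M}"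
    using assms generated_equiv_incl[of "\<lambda>n. {(s, t). (n, s, t) \<in> base_eqs M}" n]
    unfolding base_rel_def by blast
  then show ?thesis
    unfolding pill_pres_rel_def
    using generated_equiv_incl[of "\<lambda>n. base_rel M n \<union> {(s, t). (n, s, t) \<in> pill_eqs M}" n] by blast
qed

section \<open>Completeness\<close>

text \<open>\<open>S\<close> stands for an arbitrary member of the family whose intersection is
  \<open>generated_congruence\<close>. Showing that each \<open>S\<close> contains
  \<open>word_rel\<close> gives completeness directly.\<close>

locale pill_theory = monoid G for G :: "('m, 'b) monoid_scheme" (structure) +
  fixes S :: "nat \<Rightarrow> ('m sym tm \<times> 'm sym tm) set"
  assumes congruence: "clone_congruence (term_clone (sig G)) S"
    and eqs: "(n, s, t) \<in> base_eqs G \<or> (n, s, t) \<in> pill_eqs G \<Longrightarrow> (s, t) \<in> S n"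
begin

lemmas S_sym = clone_congruence_sym[OF congruence]
lemmas S_trans [trans] = clone_congruence_trans[OF congruence]

lemma S_refl: "t \<in> terms (sig G) n \<Longrightarrow> (t, t) \<in> S n"
  using clone_congruence_refl[OF congruence] by simp

lemma S_subst:
  assumes "(s, t) \<in> S n" "length ts = n" "list_all2 (\<lambda>t t'. (t, t') \<in> S m) ts ts'"
  shows "(tm_subst ts s, tm_subst ts' t) \<in> S m"
  using clone_congruence_superpos[OF congruence assms] by simp

lemma S_eqs_subst:
  assumes "(n, s, t) \<in> base_eqs G \<or> (n, s, t) \<in> pill_eqs G"
    and "length ts = n" "\<forall>t\<in>set ts. t \<in> terms (sig G) m"
  shows "(tm_subst ts s, tm_subst ts t) \<in> S m"
  using assms by (intro S_subst[OF eqs]) (simp_all add: list_all2_same S_refl)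

lemma S_star:
  assumes "(s, s') \<in> S n" "(t, t') \<in> S n"
  shows "(star_tm s t, star_tm s' t') \<in> S n"
  using S_subst[of "star_tm (Var 1) (Var 2)" "star_tm (Var 1) (Var 2)" 2 "[s, t]" n "[s', t']"] assms
  by (simp add: S_refl)

lemma S_pig:
  assumes "\<alpha> \<in> carrier G" "(t, t') \<in> S n"
  shows "(pig_tm \<alpha> t, pig_tm \<alpha> t') \<in> S n"
  using S_subst[of "pig_tm \<alpha> (Var 1)" "pig_tm \<alpha> (Var 1)" 1 "[t]" n "[t']"] assms
  by (simp add: S_refl)

lemma S_base:
  "\<lbrakk>r \<in> terms (sig G) n; s \<in> terms (sig G) n; t \<in> terms (sig G) n\<rbrakk>
    \<Longrightarrow> (star_tm (star_tm r s) t, star_tm r (star_tm s t)) \<in> S n"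
  "t \<in> terms (sig G) n \<Longrightarrow> (star_tm unit_tm t, t) \<in> S n"
  "t \<in> terms (sig G) n \<Longrightarrow> (t, star_tm t unit_tm) \<in> S n"
  "\<lbrakk>\<alpha> \<in> carrier G; s \<in> terms (sig G) n; t \<in> terms (sig G) n\<rbrakk>
    \<Longrightarrow> (pig_tm \<alpha> (star_tm s t), star_tm (pig_tm \<alpha> s) (pig_tm \<alpha> t)) \<in> S n"
  "\<alpha> \<in> carrier G \<Longrightarrow> (pig_tm \<alpha> unit_tm, unit_tm) \<in> S n"
  "\<lbrakk>\<alpha> \<in> carrier G; \<beta> \<in> carrier G; t \<in> terms (sig G) n\<rbrakk>
    \<Longrightarrow> (pig_tm \<alpha> (pig_tm \<beta> t), pig_tm (\<alpha> \<otimes> \<beta>) t) \<in> S n"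
  "t \<in> terms (sig G) n \<Longrightarrow> (pig_tm \<one> t, t) \<in> S n"
  using S_eqs_subst[OF disjI1[OF base_eqs.star_assoc], of "[r, s, t]" n]
    S_eqs_subst[OF disjI1[OF base_eqs.star_unit_left], of "[t]" n]
    S_eqs_subst[OF disjI1[OF base_eqs.star_unit_right], of "[t]" n]
    S_eqs_subst[OF disjI1[OF base_eqs.pig_star[of \<alpha>]], of "[s, t]" n]
    S_eqs_subst[OF disjI1[OF base_eqs.pig_unit[of \<alpha>]], of "[]" n]
    S_eqs_subst[OF disjI1[OF base_eqs.pig_pig[of \<alpha> _ \<beta>]], of "[t]" n]
    S_eqs_subst[OF disjI1[OF base_eqs.pig_one], of "[t]" n]
  by simp_all

section \<open>Right combs as normal forms modulo the base equations\<close>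

lemma rc_append:
  assumes "p \<in> pwords G n" "q \<in> pwords G n"
  shows "(star_tm (rc p) (rc q), rc (p @ q)) \<in> S n"
  using assms(1)
proof (induction rule: pwords_induct)
  case Nil
  then show ?case using assms(2) by (simp add: S_base(2) rc_terms)
next
  case (Cons i \<alpha> p)
  let ?x = "pig_tm \<alpha> (Var i)"
  have "(star_tm (star_tm ?x (rc p)) (rc q), star_tm ?x (star_tm (rc p) (rc q))) \<in> S n"
    using Cons assms(2) by (intro S_base(1)) (simp_all add: rc_terms)
  also have "(star_tm ?x (star_tm (rc p) (rc q)), star_tm ?x (rc (p @ q))) \<in> S n"
    using Cons by (intro S_star S_refl) simp_all
  finally show ?case by simp
qed

lemma rc_pigment_act:
  assumes "p \<in> pwords G n" "\<alpha> \<in> carrier G"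
  shows "(pig_tm \<alpha> (rc p), rc (pigment_act G \<alpha> p)) \<in> S n"
  using assms(1)
proof (induction rule: pwords_induct)
  case Nil
  then show ?case using assms(2) by (simp add: S_base(5))
next
  case (Cons i \<beta> p)
  let ?x = "pig_tm \<beta> (Var i)"
  have "(pig_tm \<alpha> (star_tm ?x (rc p)), star_tm (pig_tm \<alpha> ?x) (pig_tm \<alpha> (rc p))) \<in> S n"
    using Cons assms(2) by (intro S_base(4)) (simp_all add: rc_terms)
  also have "(star_tm (pig_tm \<alpha> ?x) (pig_tm \<alpha> (rc p)),
      star_tm (pig_tm (\<alpha> \<otimes> \<beta>) (Var i)) (rc (pigment_act G \<alpha> p))) \<in> S n"
    using Cons assms(2) by (intro S_star S_base(6)) simp_all
  finally show ?case by simp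
qed

lemma rc_term_word: "t \<in> terms (sig G) n \<Longrightarrow> (t, rc (term_word G t)) \<in> S n"
proof (induction rule: sig_terms_induct)
  case (Var i)
  then have "(Var i, pig_tm \<one> (Var i)) \<in> S n"
    by (intro S_sym[OF S_base(7)]) simp
  also have "(pig_tm \<one> (Var i), star_tm (pig_tm \<one> (Var i)) unit_tm) \<in> S n"
    using Var by (intro S_base(3)) simp
  finally show ?case by simp
next
  case Unit
  then show ?case by (simp add: S_refl)
next
  case (Pig \<alpha> t)
  have "(pig_tm \<alpha> t, pig_tm \<alpha> (rc (term_word G t))) \<in> S n"
    using Pig by (intro S_pig) simp_all
  also have "(pig_tm \<alpha> (rc (term_word G t)), rc (pigment_act G \<alpha> (term_word G t))) \<in> S n"
    using Pig by (intro rc_pigment_act term_word_closed)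
  finally show ?case by simp
next
  case (Star s t)
  have "(star_tm s t, star_tm (rc (term_word G s)) (rc (term_word G t))) \<in> S n"
    using Star by (intro S_star) simp_all
  also have "(star_tm (rc (term_word G s)) (rc (term_word G t)),
      rc (term_word G s @ term_word G t)) \<in> S n"
    using Star by (intro rc_append term_word_closed)
  finally show ?case by simp
qed

text \<open>Substituting into a right comb does not yield a right comb in general. Normalizing both
  sides again turns each instance of the additional equations into an equation between
  words.\<close>

lemma rc_pill_eqs:
  assumes "(n, s, t) \<in> pill_eqs G" "length ts = n" "\<forall>t\<in>set ts. t \<in> terms (sig G) m"
  shows "(rc (term_word G (tm_subst ts s)), rc (term_word G (tm_subst ts t))) \<in> S m"
proof -
  have "tm_subst ts u \<in> terms (sig G) m" if "u \<in> terms (sig G) n" for u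
    using clone.superpos_closed[OF clone_term_clone[of "sig G"], of u n ts m] that assms
    by (auto simp: tuples_def)
  then have "(tm_subst ts s, rc (term_word G (tm_subst ts s))) \<in> S m"
    "(tm_subst ts t, rc (term_word G (tm_subst ts t))) \<in> S m"
    using pill_eqs_sound[OF assms(1)] by (simp_all add: rc_term_word)
  moreover have "(tm_subst ts s, tm_subst ts t) \<in> S m"
    using assms by (intro S_eqs_subst) simp_all
  ultimately show ?thesis
    using S_sym S_trans by blast
qed

section \<open>From the additional equations to exchanges of adjacent letters\<close>

lemma rc_context:
  assumes "(rc p, rc q) \<in> S n" "u \<in> pwords G n" "v \<in> pwords G n" "p \<in> pwords G n" "q \<in> pwords G n"
  shows "(rc (u @ p @ v), rc (u @ q @ v)) \<in> S n"
proof -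
  have expand: "(rc (u @ r @ v), star_tm (rc u) (star_tm (rc r) (rc v))) \<in> S n"
    if "r \<in> pwords G n" for r
  proof (rule S_sym)
    have "(star_tm (rc u) (star_tm (rc r) (rc v)), star_tm (rc u) (rc (r @ v))) \<in> S n"
      using that assms(2,3) by (intro S_star rc_append S_refl rc_terms)
    also have "(star_tm (rc u) (rc (r @ v)), rc (u @ r @ v)) \<in> S n"
      using that assms(2,3) by (intro rc_append) simp_all
    finally show "(star_tm (rc u) (star_tm (rc r) (rc v)), rc (u @ r @ v)) \<in> S n" .
  qed
  have "(rc (u @ p @ v), star_tm (rc u) (star_tm (rc p) (rc v))) \<in> S n"
    using assms(4) by (rule expand)
  also have "(star_tm (rc u) (star_tm (rc p) (rc v)), star_tm (rc u) (star_tm (rc q) (rc v))) \<in> S n"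
    using assms(1-3) by (intro S_star S_refl rc_terms)
  also have "(star_tm (rc u) (star_tm (rc q) (rc v)), rc (u @ q @ v)) \<in> S n"
    using assms(5) by (intro S_sym[OF expand])
  finally show ?thesis .
qed

text \<open>The letters with values 2 and 3 have unit pigment in the equation, so they are
  placeholders for whole words: substituting \<open>rc u\<close> and \<open>rc v\<close> inserts
  \<open>u\<close> and \<open>v\<close> unchanged.\<close>

lemma rc_middle:
  assumes "1 \<le> a" "a \<le> n" "\<alpha>1 \<in> carrier G" "\<alpha>2 \<in> carrier G" "\<alpha>3 \<in> carrier G"
    and u: "u \<in> pwords G n" and v: "v \<in> pwords G n"
  shows "(rc ((a, \<alpha>1) # (a, \<alpha>2) # u @ v @ [(a, \<alpha>3)]), rc ((a, \<alpha>1) # u @ (a, \<alpha>2) # v @ [(a, \<alpha>3)])) \<in> S n"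
  using rc_pill_eqs[OF pill_eqs.middle1[of \<alpha>1 _ \<alpha>2 \<alpha>3], of "[Var a, rc u, rc v]" n] assms
  by (simp add: rc_terms term_word_rc[OF u] term_word_rc[OF v] pigment_act_one[OF u] pigment_act_one[OF v])

lemma rc_middle_swap:
  assumes "1 \<le> a" "a \<le> n" "\<alpha>1 \<in> carrier G" "\<alpha>2 \<in> carrier G" "\<alpha>3 \<in> carrier G"
    and "u \<in> pwords G n" "v \<in> pwords G n" "[z] \<in> pwords G n"
  shows "(rc ((a, \<alpha>1) # u @ z # (a, \<alpha>2) # v @ [(a, \<alpha>3)]),
    rc ((a, \<alpha>1) # u @ (a, \<alpha>2) # z # v @ [(a, \<alpha>3)])) \<in> S n"
proof -
  have "z # v \<in> pwords G n" using assms(7,8) by (cases z) simp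
  \<comment> \<open>Both words equal the one in which the moving letter directly follows the first
    one. Counting \<open>z\<close> to the right block gives one of them, counting it to the left
    block gives the other.\<close>
  then have "(rc ((a, \<alpha>1) # (a, \<alpha>2) # u @ (z # v) @ [(a, \<alpha>3)]),
      rc ((a, \<alpha>1) # u @ (a, \<alpha>2) # (z # v) @ [(a, \<alpha>3)])) \<in> S n"
    using assms by (intro rc_middle)
  moreover have "(rc ((a, \<alpha>1) # (a, \<alpha>2) # (u @ [z]) @ v @ [(a, \<alpha>3)]),
      rc ((a, \<alpha>1) # (u @ [z]) @ (a, \<alpha>2) # v @ [(a, \<alpha>3)])) \<in> S n"
    using assms by (intro rc_middle) simp_all
  ultimately show ?thesis
    using S_sym S_trans by (metis append.assoc append_Cons append_Nil)
qed

lemma rc_exchange: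
  assumes "1 \<le> a" "a \<le> n" "1 \<le> b" "b \<le> n"
    and "\<alpha>1 \<in> carrier G" "\<alpha>2 \<in> carrier G" "\<beta>1 \<in> carrier G" "\<beta>2 \<in> carrier G"
    and u: "u \<in> pwords G n" and v: "v \<in> pwords G n"
  shows "(rc ((a, \<alpha>1) # u @ (b, \<beta>1) # (a, \<alpha>2) # v @ [(b, \<beta>2)]),
    rc ((a, \<alpha>1) # u @ (a, \<alpha>2) # (b, \<beta>1) # v @ [(b, \<beta>2)])) \<in> S n"
  using rc_pill_eqs[OF pill_eqs.exchange[of \<alpha>1 _ \<alpha>2 \<beta>1 \<beta>2], of "[Var a, rc u, Var b, rc v]" n] assms
  by (simp add: rc_terms term_word_rc[OF u] term_word_rc[OF v] pigment_act_one[OF u] pigment_act_one[OF v])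

lemma vals_split:
  assumes "i \<in> vals p" "p \<in> pwords G n"
  obtains p1 \<alpha> p2 where "p = p1 @ (i, \<alpha>) # p2" "\<alpha> \<in> carrier G" "p1 \<in> pwords G n" "p2 \<in> pwords G n"
proof -
  from assms(1) obtain \<alpha> where "(i, \<alpha>) \<in> set p" by auto
  then obtain p1 p2 where "p = p1 @ (i, \<alpha>) # p2" by (meson split_list)
  then show ?thesis using assms(2) that by simp
qed

text \<open>An occurrence of one of the two values before the pair and one after it serve as the
  outer letters of an equation. If both have the same value, this is a middle move of the letter
  with that value; if they have different roles, it is the exchange equation, read in one direction
  or the other.\<close>

lemma rc_swap:
  assumes w: "w \<in> pwords G n" and s: "s \<in> pwords G n"
    and z: "z \<in> {1..n} \<times> carrier G" and y: "y \<in> {1..n} \<times> carrier G"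
    and left: "fst y \<in> vals w \<or> fst z \<in> vals w" and right: "fst y \<in> vals s \<or> fst z \<in> vals s"
  shows "(rc (w @ z # y # s), rc (w @ y # z # s)) \<in> S n"
proof -
  obtain a \<alpha> where y_eq: "y = (a, \<alpha>)" and a: "1 \<le> a" "a \<le> n" "\<alpha> \<in> carrier G"
    using y by (cases y) simp
  obtain b \<beta> where z_eq: "z = (b, \<beta>)" and b: "1 \<le> b" "b \<le> n" "\<beta> \<in> carrier G"
    using z by (cases z) simp
  \<comment> \<open>The equations start and end with the chosen occurrences \<open>c\<close> and
    \<open>d\<close>; what lies outside is context. Any occurrences will do, since the blocks in
    between are arbitrary words.\<close>
  have extend: ?thesis
    if "w = w1 @ c # w2" "s = s1 @ d # s2"
      "(rc (c # w2 @ z # y # s1 @ [d]), rc (c # w2 @ y # z # s1 @ [d])) \<in> S n"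
    for w1 c w2 s1 d s2
  proof -
    have "w1 \<in> pwords G n" "s2 \<in> pwords G n" "c # w2 \<in> pwords G n" "s1 @ [d] \<in> pwords G n"
      using w s that(1,2) by (cases d, simp)+
    then have "(rc (w1 @ (c # w2 @ z # y # s1 @ [d]) @ s2), rc (w1 @ (c # w2 @ y # z # s1 @ [d]) @ s2)) \<in> S n"
      using a b by (intro rc_context[OF that(3)]) (cases c; simp add: y_eq z_eq)+
    then show ?thesis using that(1,2) by simp
  qed
  consider "a \<in> vals w" "b \<in> vals s" | "b \<in> vals w" "a \<in> vals s"
    | "a \<in> vals w" "a \<in> vals s" | "b \<in> vals w" "b \<in> vals s"
    using left right unfolding y_eq z_eq fst_conv by argo
  then show ?thesis
  proof cases
    case 1
    obtain w1 \<gamma> w2 where W: "w = w1 @ (a, \<gamma>) # w2" "\<gamma> \<in> carrier G" "w2 \<in> pwords G n"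
      using 1(1) w by (rule vals_split)
    obtain s1 \<delta> s2 where X: "s = s1 @ (b, \<delta>) # s2" "\<delta> \<in> carrier G" "s1 \<in> pwords G n"
      using 1(2) s by (rule vals_split)
    show ?thesis
      by (rule extend[OF W(1) X(1)], unfold y_eq z_eq, rule rc_exchange)
        (simp_all add: a b W(2,3) X(2,3) del: One_nat_def)
  next
    case 2
    obtain w1 \<gamma> w2 where W: "w = w1 @ (b, \<gamma>) # w2" "\<gamma> \<in> carrier G" "w2 \<in> pwords G n"
      using 2(1) w by (rule vals_split)
    obtain s1 \<delta> s2 where X: "s = s1 @ (a, \<delta>) # s2" "\<delta> \<in> carrier G" "s1 \<in> pwords G n"
      using 2(2) s by (rule vals_split)
    show ?thesis
      by (rule extend[OF W(1) X(1)], unfold y_eq z_eq, rule S_sym[OF rc_exchange])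
        (simp_all add: a b W(2,3) X(2,3) del: One_nat_def)
  next
    case 3
    obtain w1 \<gamma> w2 where W: "w = w1 @ (a, \<gamma>) # w2" "\<gamma> \<in> carrier G" "w2 \<in> pwords G n"
      using 3(1) w by (rule vals_split)
    obtain s1 \<delta> s2 where X: "s = s1 @ (a, \<delta>) # s2" "\<delta> \<in> carrier G" "s1 \<in> pwords G n"
      using 3(2) s by (rule vals_split)
    show ?thesis
      by (rule extend[OF W(1) X(1)], unfold y_eq z_eq, rule rc_middle_swap)
        (simp_all add: a b W(2,3) X(2,3) del: One_nat_def)
  next
    case 4
    obtain w1 \<gamma> w2 where W: "w = w1 @ (b, \<gamma>) # w2" "\<gamma> \<in> carrier G" "w2 \<in> pwords G n"
      using 4(1) w by (rule vals_split)
    obtain s1 \<delta> s2 where X: "s = s1 @ (b, \<delta>) # s2" "\<delta> \<in> carrier G" "s1 \<in> pwords G n"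
      using 4(2) s by (rule vals_split)
    show ?thesis
      by (rule extend[OF W(1) X(1)], unfold y_eq z_eq, rule S_sym[OF rc_middle_swap])
        (simp_all add: a b W(2,3) X(2,3) del: One_nat_def)
  qed
qed

lemma rc_pill_rel:
  assumes "(p, q) \<in> pill_rel G n"
  shows "(rc p, rc q) \<in> S n"
proof -
  have "(rc ([] @ p), rc ([] @ q)) \<in> S n"
  proof (rule pill_words_connected[where A = "{1..n} \<times> carrier G" and E = "\<lambda>p q. (rc p, rc q) \<in> S n"])
    show "(rc (w @ z # y # s), rc (w @ y # z # s)) \<in> S n"
      if "w \<in> lists ({1..n} \<times> carrier G)" "s \<in> lists ({1..n} \<times> carrier G)"
        "z \<in> {1..n} \<times> carrier G" "y \<in> {1..n} \<times> carrier G"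
        "fst y \<in> vals w \<or> fst z \<in> vals w" "fst y \<in> vals s \<or> fst z \<in> vals s" for w z y s
      using that by (intro rc_swap) (simp_all only: pwords_def)
    show "(rc w, rc w) \<in> S n" if "w \<in> lists ({1..n} \<times> carrier G)" for w
      using that by (intro S_refl rc_terms) (simp only: pwords_def)
    show "(rc u, rc w) \<in> S n" if "(rc u, rc v) \<in> S n" "(rc v, rc w) \<in> S n" for u v w
      using that by (rule S_trans)
  qed (use assms in \<open>simp_all add: pill_rel_def pwords_def\<close>)
  then show ?thesis by simp
qed

lemma word_rel_subset: "word_rel G n \<subseteq> S n"
proof (rule subrelI)
  fix s t
  assume "(s, t) \<in> word_rel G n"
  then have st: "s \<in> terms (sig G) n" "t \<in> terms (sig G) n"
    and "(term_word G s, term_word G t) \<in> pill_rel G n"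
    by (simp_all add: word_rel_def pullback_rel_def)
  then show "(s, t) \<in> S n"
    using rc_term_word[OF st(1)] rc_pill_rel S_sym[OF rc_term_word[OF st(2)]] S_trans by blast
qed

end

lemma (in monoid) generated_congruence_pill_pres_rel:
  "generated_congruence (term_clone (sig G)) (pill_pres_rel G) = word_rel G"
proof
  fix n
  have "word_rel G n \<subseteq> S n"
    if S: "clone_congruence (term_clone (sig G)) S" "\<forall>k. pill_pres_rel G k \<subseteq> S k" for S
  proof -
    interpret pill_theory G S
      using S eqs_pill_pres_rel by unfold_locales blast+
    show ?thesis by (rule word_rel_subset)
  qed
  moreover have "generated_congruence (term_clone (sig G)) (pill_pres_rel G) n \<subseteq> word_rel G n"
    unfolding generated_congruence_def using word_rel_congruence pill_pres_rel_word_rel by blast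
  ultimately show "generated_congruence (term_clone (sig G)) (pill_pres_rel G) n = word_rel G n"
    unfolding generated_congruence_def by blast
qed

theorem theorem5p3p8:
  fixes M :: "('m, 'b) monoid_scheme"
  assumes "monoid M"
  shows "presentation_of (sig M) (pill_pres_rel M) (Pill11 M)"
proof -
  interpret monoid M by fact
  have "clone (Pill11 M)"
    unfolding Pill11_def using clone_pword_clone pill_rel_congruence by (rule clone_quotient_clone)
  moreover have "clone_isomorphic (Pill11 M)
      (quotient_clone (term_clone (sig M)) (generated_congruence (term_clone (sig M)) (pill_pres_rel M)))"
    \<comment> \<open>Once the generated congruence is known to be a pullback along a surjective
      homomorphism, the isomorphism is an instance of the general theorem.\<close>
    unfolding Pill11_def generated_congruence_pill_pres_rel word_rel_def
    using clone_term_clone clone_pword_clone term_word_hom pill_rel_congruence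
    by (rule pullback_quotient_iso) (simp add: term_word_surj)
  ultimately show ?thesis
    using pill_pres_rel_equiv by (simp add: presentation_of_def)
qed

end
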